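(* Let $\beta>0$ and $f\in H^1((0,1))$. For every integer $n\ge2$ let $$m(n,\beta,f):=\min\Bigl\{\int_0^{1-1/n}\log\Bigl(1+\Bigl(\frac{u(x+1/n)-u(x)}{1/n}\Bigr)^2\Bigr)dx+\beta\int_0^1(u(x)-f(x))^2\,dx:\ u\in PC_{1/n}(0,1)\Bigr\}$$ and $\omega(n):=(\log n/n)^{1/3}$. Then $$\lim_{n\to+\infty}\frac{m(n,\beta,f)}{\omega(n)^2}=\beta^{1/3}\int_0^1|f'(x)|^{2/3}\,dx.$$
   Context: $PC_{1/n}(0,1)$ is the space of functions $u:[0,1]\to\mathbb{R}$ that are constant on each interval $[k/n,(k+1)/n)$, $k\in\{0,\dots,n-1\}$, with the convention $u(1):=u(1-1/n)$. *)

theory Defs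
  imports "HOL-Analysis.Analysis"
begin

text \<open>Piecewise constant functions on the grid of step 1/n in [0,1],
  with the convention u 1 = u (1 - 1/n). Values outside [0,1] are irrelevant.\<close>
definition PC :: "nat \<Rightarrow> (real \<Rightarrow> real) set" where
  "PC n = {u. (\<forall>k<n. \<forall>x\<in>{real k / real n..<(real k + 1) / real n}. u x = u (real k / real n))
              \<and> u 1 = u (1 - 1 / real n)}"

definition energy :: "nat \<Rightarrow> real \<Rightarrow> (real \<Rightarrow> real) \<Rightarrow> (real \<Rightarrow> real) \<Rightarrow> real" where
  "energy n \<beta> f u =
     integral {0..1 - 1 / real n}
       (\<lambda>x. ln (1 + ((u (x + 1 / real n) - u x) / (1 / real n))^2))
     + \<beta> * integral {0..1} (\<lambda>x. (u x - f x)^2)"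

definition m_min :: "nat \<Rightarrow> real \<Rightarrow> (real \<Rightarrow> real) \<Rightarrow> real" where
  "m_min n \<beta> f = Inf (energy n \<beta> f ` PC n)"

definition omega :: "nat \<Rightarrow> real" where
  "omega n = (ln (real n) / real n) powr (1/3)"

text \<open>f is (the continuous representative of) an element of H^1((0,1)) with weak derivative g.\<close>
definition H1_with_deriv :: "(real \<Rightarrow> real) \<Rightarrow> (real \<Rightarrow> real) \<Rightarrow> bool" where
  "H1_with_deriv f g \<longleftrightarrow>
     g absolutely_integrable_on {0..1} \<and> (\<lambda>x. (g x)^2) integrable_on {0..1} \<and>
     (\<forall>x\<in>{0..1}. f x = f 0 + integral {0..x} g)"

end

theory Submission
  imports Defs "HOL-Real_Asymp.Real_Asymp"
begin

text \<open>
  At the length scale \<open>w = omega n\<close> the function \<open>f\<close> looks affine with some slope \<open>M\<close>, and a good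
  competitor is a staircase. A jump of size about \<open>w\<close> costs \<open>4/3 * ln n / n = 4/3 * w^3\<close> to leading
  order, since \<open>ln ((n w)\<^sup>2)\<close> is asymptotic to \<open>4/3 * ln n\<close>, and a step of length \<open>d\<close> has fidelity
  at least \<open>\<beta> M\<^sup>2 d\<^sup>3 / 12\<close>, with equality for the midpoint value. By the inequality of arithmetic
  and geometric means \<open>4/3 * w^3 + \<beta> M\<^sup>2 d\<^sup>3 / 12 \<ge> w\<^sup>2 d (\<beta> M\<^sup>2) powr (1/3)\<close>, with equality
  for \<open>d = 2 w / (\<beta> M\<^sup>2) powr (1/3)\<close>, and summing over the steps gives \<open>w\<^sup>2\<close> times the limit.

  The slope is read off a continuous function \<open>\<phi>\<close> close to \<open>f'\<close> in \<open>L\<^sup>2\<close>. On a step of length \<open>O(w)\<close>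
  the error in replacing \<open>f\<close> by an affine function is \<open>O(w\<^sup>2)\<close> times the integral of \<open>(f' - M)\<^sup>2\<close>, so
  all errors sum to a small multiple of \<open>w\<^sup>2\<close>. In the lower bound the increments far below \<open>n w\<close>
  (after division by the mesh size) are ignored: their total variation tends to zero whenever the
  energy is \<open>O(w\<^sup>2)\<close>.
\<close>

section \<open>Elementary inequalities\<close>

text \<open>The power 2/3 is subadditive, which leaves |x - y|^(2/3) as the error. Either this is at
  most \<open>\<kappa>\<close>, or it is at most its cube divided by
  \<open>\<kappa>\<^sup>2\<close>. The second form turns closeness in L^2 into closeness of the
  integrals of the power 2/3.\<close>

lemma powr_two_thirds_le:
  fixes x y \<kappa> :: real
  assumes "\<kappa> > 0"
  shows "\<bar>x\<bar> powr (2/3) \<le> \<bar>y\<bar> powr (2/3) + \<kappa> + (x - y)\<^sup>2 / \<kappa>\<^sup>2"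
proof -
  define s t where "s = root 3 \<bar>y\<bar>" and "t = root 3 \<bar>x - y\<bar>"
  have nn: "s \<ge> 0" "t \<ge> 0" by (auto simp: s_def t_def)
  have p: "\<bar>z\<bar> powr (2/3) = (root 3 \<bar>z\<bar>)\<^sup>2" for z :: real
  proof (cases "z = 0")
    case False
    then have "(root 3 \<bar>z\<bar>)\<^sup>2 = (\<bar>z\<bar> powr (1/3)) powr 2"
      by (subst powr_numeral) (auto simp: root_powr_inverse)
    then show ?thesis by (simp add: powr_powr)
  qed simp
  define r where "r = root 3 \<bar>x\<bar>"
  have r0: "r \<ge> 0" by (simp add: r_def)
  have "r^3 \<le> s^3 + t^3" by (simp add: r_def s_def t_def odd_real_root_pow)
  then have "(r^3)\<^sup>2 \<le> (s^3 + t^3)\<^sup>2" using r0 by (intro power_mono) auto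
  \<comment> \<open>The difference of the two cubes is arranged as a product of nonnegative factors,
    so its sign can be read off.\<close>
  also have "\<dots> = (s\<^sup>2 + t\<^sup>2)^3 - s\<^sup>2 * t\<^sup>2 * (2 * s\<^sup>2 + 2 * t\<^sup>2 + (s - t)\<^sup>2)"
    by (simp add: power2_eq_square power3_eq_cube algebra_simps)
  also have "\<dots> \<le> (s\<^sup>2 + t\<^sup>2)^3" by simp
  finally have "(r\<^sup>2)^3 \<le> (s\<^sup>2 + t\<^sup>2)^3" by (simp flip: power_mult add: mult.commute)
  then have 1: "r\<^sup>2 \<le> s\<^sup>2 + t\<^sup>2" by (rule power_le_imp_le_base[of _ 2, simplified]) simp
  have 2: "t\<^sup>2 \<le> \<kappa> + t^6 / \<kappa>\<^sup>2"
  proof (cases "t\<^sup>2 \<le> \<kappa>")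
    case True
    have "0 \<le> t^6 / \<kappa>\<^sup>2" using nn by simp
    with True show ?thesis by linarith
  next
    case False
    then have "\<kappa>\<^sup>2 \<le> (t\<^sup>2)\<^sup>2" using assms by (intro power_mono) auto
    then have "t\<^sup>2 * \<kappa>\<^sup>2 \<le> t\<^sup>2 * (t\<^sup>2)\<^sup>2" by (intro mult_left_mono) auto
    then have "t\<^sup>2 \<le> t^6 / \<kappa>\<^sup>2" using assms by (simp add: field_simps flip: power_mult power_add)
    then show ?thesis using assms by linarith
  qed
  have "t^6 = (t^3)\<^sup>2" by (simp flip: power_mult)
  also have "\<dots> = (x - y)\<^sup>2" by (simp add: t_def odd_real_root_pow)
  finally show ?thesis using 1 2 unfolding p r_def s_def by simp
qed

text \<open>Twelve times the gap factors as \<open>(z*d - 2*w)\<^sup>2 * (z*d + 4*w)\<close>. The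
  double root \<open>z * d = 2 * w\<close> is the optimal step length, to be used by the
  competitor.\<close>

lemma square_cube_amgm:
  fixes w d z :: real
  assumes "w \<ge> 0" "d \<ge> 0" "z \<ge> 0"
  shows "w\<^sup>2 * d * z \<le> 4/3 * w^3 + z^3 * d^3 / 12"
proof -
  have "0 \<le> (z*d - 2*w)\<^sup>2 * (z*d + 4*w)" using assms by simp
  also have "\<dots> = 12 * (4/3 * w^3 + z^3 * d^3 / 12 - w\<^sup>2 * d * z)"
    by (simp add: power2_eq_square power3_eq_cube algebra_simps)
  finally show ?thesis by simp
qed

lemma real_cube_root: "x \<ge> 0 \<Longrightarrow> (x powr (1/3))^3 = (x::real)"
  by (cases "x = 0") (auto simp: powr_powr simp flip: powr_numeral)

text \<open>Controls the total variation of the small increments by the energy.\<close>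
lemma ln_ge_small_jump:
  fixes y Y :: real
  assumes "Y \<ge> 1" "0 \<le> y" "y \<le> Y"
  shows "y \<le> 1 / Y + 2 * Y * ln (1 + y\<^sup>2)"
proof -
  have nn: "ln (1 + y\<^sup>2) \<ge> 0" by simp
  have lb: "y\<^sup>2 / (1 + y\<^sup>2) \<le> ln (1 + y\<^sup>2)"
  proof -
    have "ln (1 / (1 + y\<^sup>2)) \<le> 1 / (1 + y\<^sup>2) - 1"
      by (rule ln_le_minus_one) (simp add: add_pos_nonneg)
    moreover have "1 - 1 / (1 + y\<^sup>2) = y\<^sup>2 / (1 + y\<^sup>2)"
      by (simp add: field_simps add_nonneg_eq_0_iff)
    moreover have "1 + y\<^sup>2 \<noteq> 0" by (simp add: add_nonneg_eq_0_iff)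
    ultimately show ?thesis by (simp add: ln_div)
  qed
  \<comment> \<open>Below 1/Y the first summand suffices. Between 1/Y and 1 one has y <= Y y^2 and
    y^2 <= 2 ln (1 + y^2). Above 1 the logarithm is at least 1/2 and y <= Y.\<close>
  consider "y \<le> 1/Y" | "1/Y \<le> y" "y \<le> 1" | "1 \<le> y" by linarith
  then show ?thesis
  proof cases
    case 1
    have "0 \<le> 2 * Y * ln (1 + y\<^sup>2)" using nn assms by simp
    with 1 show ?thesis by linarith
  next
    case 2
    have "y\<^sup>2 \<le> 1" using 2 assms by (simp add: power_le_one)
    then have "y\<^sup>2 \<le> 2 * (y\<^sup>2 / (1 + y\<^sup>2))"
      using power_decreasing[of 2 4 y] 2 assms
      by (simp add: field_simps add_pos_nonneg)
    also have "\<dots> \<le> 2 * ln (1 + y\<^sup>2)" using lb by simp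
    finally have "Y * y\<^sup>2 \<le> Y * (2 * ln (1 + y\<^sup>2))" using assms by (intro mult_left_mono) auto
    moreover have "y \<le> Y * y\<^sup>2"
      using mult_left_mono[of 1 "Y * y" y] 2 assms by (auto simp: field_simps power2_eq_square)
    moreover have "1 / Y \<ge> 0" using assms by simp
    ultimately have "y \<le> 1 / Y + Y * (2 * ln (1 + y\<^sup>2))" by linarith
    then show ?thesis by (simp add: mult_ac)
  next
    case 3
    then have "1 \<le> y\<^sup>2" by simp
    then have "1 / 2 \<le> y\<^sup>2 / (1 + y\<^sup>2)" by (simp add: field_simps)
    with lb have "1 \<le> 2 * ln (1 + y\<^sup>2)" by linarith
    then have "Y * 1 \<le> Y * (2 * ln (1 + y\<^sup>2))" using assms by (intro mult_left_mono) auto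
    moreover have "1 / Y \<ge> 0" using assms by simp
    ultimately have "y \<le> 1 / Y + Y * (2 * ln (1 + y\<^sup>2))" using assms by linarith
    then show ?thesis by (simp add: mult_ac)
  qed
qed

text \<open>Young's inequality with weight \<open>\<eta>\<close>. In the applications
  \<open>A\<close> is the affine main part, which loses only a fraction \<open>\<eta>\<close>, while
  the small remainder \<open>B\<close> bears the factor \<open>1 / \<eta>\<close>.\<close>

lemma sq_add_lower:
  fixes A B \<eta> :: real
  assumes "\<eta> > 0"
  shows "(1 - \<eta>) * A\<^sup>2 - B\<^sup>2 / \<eta> \<le> (A + B)\<^sup>2"
proof -
  have "0 \<le> (\<eta> * A + B)\<^sup>2 / \<eta> + B\<^sup>2" using assms by simp
  also have "\<dots> = (A + B)\<^sup>2 - ((1 - \<eta>) * A\<^sup>2 - B\<^sup>2 / \<eta>)"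
    using assms by (simp add: field_simps power2_eq_square)
  finally show ?thesis by simp
qed

lemma sq_add_upper:
  fixes A B \<eta> :: real
  assumes "\<eta> > 0"
  shows "(A + B)\<^sup>2 \<le> (1 + \<eta>) * A\<^sup>2 + (1 + 1/\<eta>) * B\<^sup>2"
proof -
  have "0 \<le> (\<eta> * A - B)\<^sup>2 / \<eta>" using assms by simp
  also have "\<dots> = (1 + \<eta>) * A\<^sup>2 + (1 + 1/\<eta>) * B\<^sup>2 - (A + B)\<^sup>2"
    using assms by (simp add: field_simps power2_eq_square)
  finally show ?thesis by simp
qed

text \<open>The mean square splits into the squared value at the midpoint and a variance that does
  not depend on \<open>c\<close>. The lower bound drops the former; the competitor makes it
  vanish.\<close>

lemma affine_has_integral:
  fixes a b c M :: real
  assumes "a \<le> b"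
  shows "((\<lambda>x. (c - M * (x - a))\<^sup>2) has_integral
    (b - a) * (c - M * (b - a) / 2)\<^sup>2 + M\<^sup>2 * (b - a)^3 / 12) {a..b}"
proof -
  let ?F = "\<lambda>x. c\<^sup>2 * (x - a) - c * M * (x - a)\<^sup>2 + M\<^sup>2 * (x - a)^3 / 3"
  have "((\<lambda>x. (c - M * (x - a))\<^sup>2) has_integral ?F b - ?F a) {a..b}"
    by (rule fundamental_theorem_of_calculus[OF assms])
      (auto intro!: derivative_eq_intros simp: has_real_derivative_iff_has_vector_derivative[symmetric]
        power2_eq_square field_simps)
  moreover have "?F b - ?F a = (b - a) * (c - M * (b - a) / 2)\<^sup>2 + M\<^sup>2 * (b - a)^3 / 12"
    by (simp add: power2_eq_square power3_eq_cube field_simps)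
  ultimately show ?thesis by simp
qed

section \<open>Integrals assembled cell by cell\<close>

lemma has_integral_cells:
  fixes F :: "nat \<Rightarrow> real \<Rightarrow> real"
  assumes "n > 0"
    and F: "\<And>k. k < j \<Longrightarrow> F k integrable_on {real k / real n..(real k + 1) / real n}"
    and w: "\<And>k x. k < j \<Longrightarrow> x \<in> {real k / real n..<(real k + 1) / real n} \<Longrightarrow> w x = F k x"
  shows "(w has_integral (\<Sum>k<j. integral {real k / real n..(real k + 1) / real n} (F k)))
    {0..real j / real n}"
  using F w
proof (induction j)
  case 0
  then show ?case by (simp add: has_integral_refl)
next
  case (Suc j)
  have A: "(w has_integral (\<Sum>k<j. integral {real k / real n..(real k + 1) / real n} (F k)))
    {0..real j / real n}" using Suc by auto
  have "(F j has_integral integral {real j / real n..(real j + 1) / real n} (F j))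
      {real j / real n..(real j + 1) / real n}"
    using Suc.prems(1)[of j] by auto
  \<comment> \<open>The integrand is known only on the half-open cell, as in \<open>PC\<close>; the
    right endpoint is a single exceptional point.\<close>
  then have "(w has_integral integral {real j / real n..(real j + 1) / real n} (F j))
      {real j / real n..(real j + 1) / real n}"
    by (rule has_integral_spike_finite[where S="{(real j + 1) / real n}", rotated 2])
      (auto intro!: Suc.prems(2))
  from has_integral_combine[OF _ _ A this] show ?case
    using \<open>n > 0\<close> by (simp add: field_simps)
qed

lemma integral_cells:
  fixes h :: "real \<Rightarrow> real"
  assumes "n > 0" "i \<le> j" and h: "h integrable_on {real i / real n..real j / real n}"
  shows "(\<Sum>k\<in>{i..<j}. integral {real k / real n..(real k + 1) / real n} h)
    = integral {real i / real n..real j / real n} h"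
  using assms(2,3)
proof (induction j rule: dec_induct)
  case base
  then show ?case by simp
next
  case (step j)
  have le: "real i / real n \<le> real j / real n" "real j / real n \<le> real (Suc j) / real n"
    using step \<open>n > 0\<close> by (auto simp: field_simps)
  have "h integrable_on {real i / real n..real j / real n}"
    using step.prems by (rule integrable_on_subinterval) (use le in auto)
  with step Henstock_Kurzweil_Integration.integral_combine[OF le step.prems] show ?case
    by (simp add: algebra_simps)
qed

section \<open>Functions in \<open>H\<^sup>1\<close>\<close>

lemma H1_continuous:
  assumes "H1_with_deriv f g"
  shows "continuous_on {0..1} f"
proof -
  have "g integrable_on {0..1}"
    using assms unfolding H1_with_deriv_def absolutely_integrable_on_def by blast
  then have "continuous_on {0..1} (\<lambda>x. f 0 + integral {0..x} g)"
    by (intro continuous_intros indefinite_integral_continuous_1)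
  then show ?thesis
    using assms unfolding H1_with_deriv_def by (metis (no_types, lifting) continuous_on_cong)
qed

lemma H1_diff:
  assumes "H1_with_deriv f g" "0 \<le> a" "a \<le> b" "b \<le> 1"
  shows "f b - f a = integral {a..b} g"
proof -
  have g: "g integrable_on {0..1}"
    using assms unfolding H1_with_deriv_def absolutely_integrable_on_def by blast
  have "integral {0..a} g + integral {a..b} g = integral {0..b} g"
    using assms by (intro Henstock_Kurzweil_Integration.integral_combine integrable_on_subinterval[OF g]) auto
  moreover have "f b = f 0 + integral {0..b} g" "f a = f 0 + integral {0..a} g"
    using assms unfolding H1_with_deriv_def by (meson atLeastAtMost_iff order_trans)+
  ultimately show ?thesis by simp
qed

text \<open>The square of \<open>h\<close> minus its mean \<open>m\<close> is nonnegative; expanding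
  it and integrating gives the Cauchy-Schwarz inequality against the constant 1.\<close>

lemma integral_sq_Cauchy:
  fixes h :: "real \<Rightarrow> real"
  assumes "a \<le> b" "h integrable_on {a..b}" "(\<lambda>x. (h x)\<^sup>2) integrable_on {a..b}"
  shows "(integral {a..b} h)\<^sup>2 \<le> (b - a) * integral {a..b} (\<lambda>x. (h x)\<^sup>2)"
proof (cases "a = b")
  case False
  define I m where "I = integral {a..b} h" and "m = I / (b - a)"
  have ab: "b - a > 0" using False assms by simp
  have "((\<lambda>x. (h x)\<^sup>2 - 2 * m * h x + m\<^sup>2) has_integral
      (integral {a..b} (\<lambda>x. (h x)\<^sup>2) - 2 * m * I + m\<^sup>2 * (b - a))) {a..b}"
    unfolding I_def
    by (intro has_integral_add has_integral_diff has_integral_mult_right integrable_integral assms)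
      (use has_integral_const_real[of "m\<^sup>2" a b] assms in \<open>simp add: mult.commute\<close>)
  moreover have nn: "0 \<le> (h x)\<^sup>2 - 2 * m * h x + m\<^sup>2" for x
    using zero_le_power2[of "h x - m"] unfolding power2_diff by (simp add: mult_ac)
  ultimately have "0 \<le> integral {a..b} (\<lambda>x. (h x)\<^sup>2) - 2 * m * I + m\<^sup>2 * (b - a)"
    using has_integral_nonneg by blast
  also have "\<dots> = integral {a..b} (\<lambda>x. (h x)\<^sup>2) - I\<^sup>2 / (b - a)"
  proof -
    have "m * (b - a) = I" using ab by (simp add: m_def)
    then have "m\<^sup>2 * (b - a) = m * I" by (simp add: power2_eq_square)
    moreover have "m * I = I\<^sup>2 / (b - a)" by (simp add: m_def power2_eq_square)
    ultimately show ?thesis by simp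
  qed
  finally show ?thesis using ab by (simp add: field_simps I_def)
qed auto

lemma H1_integrable:
  assumes "H1_with_deriv f g" "continuous_on {0..1} \<phi>"
  shows "(\<lambda>x. g x - \<phi> x) integrable_on {0..1}"
    and "(\<lambda>x. (g x - \<phi> x)\<^sup>2) integrable_on {0..1}"
    and "(\<lambda>x. (\<bar>g x - \<phi> x\<bar> + \<rho>)\<^sup>2) integrable_on {0..1}"
    and "(\<lambda>x. \<bar>g x\<bar>) integrable_on {0..1}"
    and "(\<lambda>x. \<bar>g x\<bar> powr (2/3)) integrable_on {0..1}"
proof -
  have g: "g absolutely_integrable_on {0..1}" "(\<lambda>x. (g x)\<^sup>2) integrable_on {0..1}"
    using assms unfolding H1_with_deriv_def by blast+
  have phi: "\<phi> absolutely_integrable_on {0..1}"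
    by (intro absolutely_integrable_continuous_real assms)
  have gm: "g \<in> borel_measurable (lebesgue_on {0..1})"
    using g(1) by (auto intro: absolutely_integrable_imp_borel_measurable)
  have pm: "\<phi> \<in> borel_measurable (lebesgue_on {0..1})"
    using phi by (auto intro: absolutely_integrable_imp_borel_measurable)
  \<comment> \<open>Common domination for the nonlinear integrands: a multiple of the square of
    \<open>g\<close>, integrable by hypothesis, plus a continuous function.\<close>
  have bd: "h integrable_on {0..1}" if "h \<in> borel_measurable (lebesgue_on {0..1})"
    "\<And>x. x \<in> {0..1} \<Longrightarrow> \<bar>h x\<bar> \<le> c * (g x)\<^sup>2 + k x" "continuous_on {0..1} k"
    for h c and k :: "real \<Rightarrow> real"
  proof (rule measurable_bounded_by_integrable_imp_integrable[OF that(1)])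
    show "(\<lambda>x. c * (g x)\<^sup>2 + k x) integrable_on {0..1}"
      by (intro integrable_add integrable_on_mult_right g integrable_continuous_real that)
  qed (use that in auto)
  show "(\<lambda>x. g x - \<phi> x) integrable_on {0..1}"
    using g phi by (auto intro!: integrable_diff simp: absolutely_integrable_on_def)
  show "(\<lambda>x. (g x - \<phi> x)\<^sup>2) integrable_on {0..1}"
  proof (rule bd[where c=2 and k="\<lambda>x. 2 * (\<phi> x)\<^sup>2"])
    show "\<bar>(g x - \<phi> x)\<^sup>2\<bar> \<le> 2 * (g x)\<^sup>2 + 2 * (\<phi> x)\<^sup>2" for x
    proof -
      have "(g x - \<phi> x)\<^sup>2 \<le> 2 * (g x)\<^sup>2 + 2 * (\<phi> x)\<^sup>2"
        using zero_le_power2[of "g x + \<phi> x"] unfolding power2_sum power2_diff by linarith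
      then show ?thesis by simp
    qed
  qed (use gm pm assms in \<open>auto intro!: continuous_intros\<close>)
  show "(\<lambda>x. (\<bar>g x - \<phi> x\<bar> + \<rho>)\<^sup>2) integrable_on {0..1}"
  proof (rule bd[where c=4 and k="\<lambda>x. 4 * (\<phi> x)\<^sup>2 + 2 * \<rho>\<^sup>2"])
    show "\<bar>(\<bar>g x - \<phi> x\<bar> + \<rho>)\<^sup>2\<bar> \<le> 4 * (g x)\<^sup>2 + (4 * (\<phi> x)\<^sup>2 + 2 * \<rho>\<^sup>2)" for x
    proof -
      have "(\<bar>g x - \<phi> x\<bar> + \<rho>)\<^sup>2 \<le> 2 * (\<bar>g x - \<phi> x\<bar>)\<^sup>2 + 2 * \<rho>\<^sup>2"
        using zero_le_power2[of "\<bar>g x - \<phi> x\<bar> - \<rho>"] unfolding power2_sum power2_diff by linarith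
      moreover have "(g x - \<phi> x)\<^sup>2 \<le> 2 * (g x)\<^sup>2 + 2 * (\<phi> x)\<^sup>2"
        using zero_le_power2[of "g x + \<phi> x"] unfolding power2_sum power2_diff by linarith
      ultimately show ?thesis by simp
    qed
  qed (use gm pm assms in \<open>auto intro!: continuous_intros\<close>)
  show "(\<lambda>x. \<bar>g x\<bar>) integrable_on {0..1}"
    using g by (auto simp: absolutely_integrable_on_def)
  show "(\<lambda>x. \<bar>g x\<bar> powr (2/3)) integrable_on {0..1}"
  proof (rule bd[where c=1 and k="\<lambda>x. 1"])
    show "\<bar>\<bar>g x\<bar> powr (2/3)\<bar> \<le> 1 * (g x)\<^sup>2 + 1" for x
      using powr_two_thirds_le[of 1 "g x" 0] by simp
  qed (use gm in auto)
qed

text \<open>The deviation of \<open>f\<close> from an affine function of slope \<open>M\<close> is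
  the integral of \<open>g - M\<close> between the two points, to which Cauchy-Schwarz applies. Both
  the length factor and the integral are then enlarged to the whole piece.\<close>

lemma H1_remainder:
  assumes H: "H1_with_deriv f g" and "0 \<le> a" "b \<le> 1" "x \<in> {a..b}" "y \<in> {a..b}"
  shows "(f x - f y - M * (x - y))\<^sup>2 \<le> (b - a) * integral {a..b} (\<lambda>t. (g t - M)\<^sup>2)"
  using assms(4,5)
proof (induction x y rule: linorder_wlog)
  case (sym x y)
  moreover have "f y - f x - M * (y - x) = - (f x - f y - M * (x - y))"
    by (simp add: algebra_simps)
  ultimately show ?case by (simp only: power2_minus)
next
  \<comment> \<open>Here \<open>y \<le> x\<close>, but the goal has the arguments in the order
    \<open>y\<close>, \<open>x\<close>; the sign inside the square is switched at the end.\<close>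
  case (le y x)
  have H': "(\<lambda>t. g t - M) integrable_on {0..1}" "(\<lambda>t. (g t - M)\<^sup>2) integrable_on {0..1}"
    using H1_integrable[OF H, of "\<lambda>_. M"] by auto
  have g: "g integrable_on {0..1}"
    using H unfolding H1_with_deriv_def absolutely_integrable_on_def by blast
  have sub: "{y..x} \<subseteq> {0..1}" using le assms by auto
  have "f x - f y - M * (x - y) = integral {y..x} (\<lambda>t. g t - M)"
    using H1_diff[OF H, of y x] le assms
    by (subst Henstock_Kurzweil_Integration.integral_diff)
      (auto intro!: integrable_on_subinterval[OF g] simp: algebra_simps)
  then have "(f x - f y - M * (x - y))\<^sup>2 \<le> (x - y) * integral {y..x} (\<lambda>t. (g t - M)\<^sup>2)"
    using integral_sq_Cauchy[OF le(1) integrable_on_subinterval[OF H'(1)]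
        integrable_on_subinterval[OF H'(2)]] sub by simp
  also have "\<dots> \<le> (b - a) * integral {a..b} (\<lambda>t. (g t - M)\<^sup>2)"
    using le assms sub
    by (intro mult_mono integral_subset_le integrable_on_subinterval[OF H'(2)] integral_nonneg) auto
  finally have fin: "(f x - f y - M * (x - y))\<^sup>2 \<le> (b - a) * integral {a..b} (\<lambda>t. (g t - M)\<^sup>2)" .
  show ?case
  proof -
    have "f y - f x - M * (y - x) = - (f x - f y - M * (x - y))"
      by (simp add: algebra_simps)
    then have "(f y - f x - M * (y - x))\<^sup>2 = (f x - f y - M * (x - y))\<^sup>2" by (simp only: power2_minus)
    then show ?thesis using fin by simp
  qed
qed

text \<open>Two dominated convergences. Truncating \<open>g\<close> at a large height costs little,
  with the square of \<open>g\<close> as majorant. Continuous functions converging almost everywhere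
  to \<open>g\<close>, truncated at the same height, then converge in L^2 with a constant majorant.
  Each error is doubled by (a + b)^2 <= 2 a^2 + 2 b^2, hence the quarters of
  \<open>e\<close>.\<close>

lemma L2_continuous_approx:
  fixes g :: "real \<Rightarrow> real"
  assumes g: "g absolutely_integrable_on {0..1}" and g2: "(\<lambda>x. (g x)\<^sup>2) integrable_on {0..1}"
    and "e > 0"
  obtains \<phi> where "continuous_on {0..1} \<phi>" "integral {0..1} (\<lambda>x. (g x - \<phi> x)\<^sup>2) \<le> e"
proof -
  define cl :: "real \<Rightarrow> real \<Rightarrow> real" where "cl K z = max (- K) (min K z)" for K z
  have gm: "g \<in> borel_measurable (lebesgue_on {0..1})"
    using g by (auto intro: absolutely_integrable_imp_borel_measurable)
  have clm: "(\<lambda>x. cl K (h x)) \<in> borel_measurable (lebesgue_on {0..1})"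
    if "h \<in> borel_measurable (lebesgue_on {0..1})" for h :: "real \<Rightarrow> real" and K
    unfolding cl_def using that by measurable
  have bnd: "h integrable_on {0..1}" if "h \<in> borel_measurable (lebesgue_on {0..1})"
    "\<And>x. x \<in> {0..1} \<Longrightarrow> \<bar>h x\<bar> \<le> k x" "k integrable_on {0..1}" for h k :: "real \<Rightarrow> real"
    by (rule measurable_bounded_by_integrable_imp_integrable[OF that(1,3)]) (use that in auto)
  have le1: "(g x - cl (real k) (g x))\<^sup>2 \<le> (g x)\<^sup>2" for k x
    by (intro abs_le_square_iff[THEN iffD1]) (auto simp: cl_def)
  have int1: "(\<lambda>x. (g x - cl (real k) (g x))\<^sup>2) integrable_on {0..1}" for k
    by (rule bnd[OF _ _ g2]) (use le1 gm clm[OF gm] in auto)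
  have "(\<lambda>k. integral {0..1} (\<lambda>x. (g x - cl (real k) (g x))\<^sup>2)) \<longlonglongrightarrow> integral {0..1} (\<lambda>x::real. 0)"
  proof (rule dominated_convergence(2)[where f="\<lambda>k x. (g x - cl (real k) (g x))\<^sup>2", OF int1 g2])
    show "(\<lambda>k. (g x - cl (real k) (g x))\<^sup>2) \<longlonglongrightarrow> 0" for x
    proof (rule tendsto_eventually)
      obtain N where "\<bar>g x\<bar> \<le> real N" using real_arch_simple by blast
      then have "cl (real k) (g x) = g x" if "k \<ge> N" for k using that by (auto simp: cl_def)
      then show "\<forall>\<^sub>F k in sequentially. (g x - cl (real k) (g x))\<^sup>2 = 0"
        unfolding eventually_sequentially by (intro exI[of _ N]) auto
    qed
  qed (use le1 in auto)
  then have "\<forall>\<^sub>F k in sequentially. integral {0..1} (\<lambda>x. (g x - cl (real k) (g x))\<^sup>2) < e / 4"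
    by (rule order_tendstoD) (use \<open>e > 0\<close> in auto)
  then obtain k where k: "integral {0..1} (\<lambda>x. (g x - cl (real k) (g x))\<^sup>2) < e / 4"
    unfolding eventually_sequentially by blast
  define K where "K = real k"
  have "g measurable_on {0..1}"
    using gm by (subst measurable_on_iff_borel_measurable) auto
  then obtain N G where N: "negligible N" and G: "\<And>n. continuous_on UNIV (G n)"
    and lim: "\<And>x. x \<notin> N \<Longrightarrow> (\<lambda>n. G n x) \<longlonglongrightarrow> (if x \<in> {0..1} then g x else 0)"
    unfolding measurable_on_def by blast
  define F where "F n x = (cl K (g x) - cl K (G n x))\<^sup>2" for n :: nat and x
  have Gm: "G n \<in> borel_measurable (lebesgue_on {0..1})" for n
    by (intro continuous_imp_measurable_on_sets_lebesgue continuous_on_subset[OF G]) auto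
  have Fle: "F n x \<le> (2 * K)\<^sup>2" for n x
    unfolding F_def by (intro abs_le_square_iff[THEN iffD1]) (auto simp: cl_def K_def)
  have Fint: "F n integrable_on {0..1}" for n
    by (rule bnd[where k="\<lambda>_. (2 * K)\<^sup>2"])
      (use Fle clm[OF gm] clm[OF Gm] in \<open>auto simp: F_def[abs_def]\<close>)
  \<comment> \<open>Setting the integrand to zero on the negligible set makes the convergence hold
    at every point without changing any integral.\<close>
  let ?F = "\<lambda>n x. if x \<in> N then 0 else F n x"
  have "(\<lambda>n. integral {0..1} (?F n)) \<longlonglongrightarrow> integral {0..1} (\<lambda>x::real. 0)"
  proof (rule dominated_convergence(2)[where f="?F" and h="\<lambda>_. (2 * K)\<^sup>2"])
    show "?F n integrable_on {0..1}" for n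
      by (rule integrable_spike[OF Fint N]) auto
    show "norm (?F n x) \<le> (2 * K)\<^sup>2" for n x using Fle[of n x] by (auto simp: F_def)
    show "(\<lambda>n. ?F n x) \<longlonglongrightarrow> 0" if "x \<in> {0..1}" for x
    proof (cases "x \<in> N")
      case False
      with lim[of x] that have "(\<lambda>n. G n x) \<longlonglongrightarrow> g x" by simp
      then have "(\<lambda>n. F n x) \<longlonglongrightarrow> (cl K (g x) - cl K (g x))\<^sup>2"
        unfolding F_def cl_def by (intro tendsto_intros)
      with False show ?thesis by simp
    qed simp
  qed auto
  moreover have "integral {0..1} (?F n) = integral {0..1} (F n)" for n
    by (rule integral_spike[OF N]) auto
  ultimately have "(\<lambda>n. integral {0..1} (F n)) \<longlonglongrightarrow> 0" by simp
  then have "\<forall>\<^sub>F n in sequentially. integral {0..1} (F n) < e / 4"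
    by (rule order_tendstoD) (use \<open>e > 0\<close> in auto)
  then obtain n where n: "integral {0..1} (F n) < e / 4"
    unfolding eventually_sequentially by blast
  define \<phi> where "\<phi> = (\<lambda>x. cl K (G n x))"
  have phi: "continuous_on {0..1} \<phi>"
    unfolding \<phi>_def cl_def by (intro continuous_intros continuous_on_subset[OF G]) auto
  have "integral {0..1} (\<lambda>x. (g x - \<phi> x)\<^sup>2)
    \<le> integral {0..1} (\<lambda>x. 2 * (g x - cl K (g x))\<^sup>2 + 2 * F n x)"
  proof (rule integral_le)
    show rhs: "(\<lambda>x. 2 * (g x - cl K (g x))\<^sup>2 + 2 * F n x) integrable_on {0..1}"
      using int1[of k] Fint[of n] by (intro integrable_add integrable_on_mult_right) (auto simp: K_def)
    show le: "(g x - \<phi> x)\<^sup>2 \<le> 2 * (g x - cl K (g x))\<^sup>2 + 2 * F n x" for x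
    proof -
      have "(a + b)\<^sup>2 \<le> 2 * a\<^sup>2 + 2 * b\<^sup>2" for a b :: real
        using zero_le_power2[of "a - b"] unfolding power2_sum power2_diff by linarith
      from this[of "g x - cl K (g x)" "cl K (g x) - \<phi> x"] show ?thesis
        by (simp add: F_def \<phi>_def)
    qed
    show "(\<lambda>x. (g x - \<phi> x)\<^sup>2) integrable_on {0..1}"
      by (rule bnd[OF _ _ rhs]) (use le gm clm[OF Gm] in \<open>auto simp: \<phi>_def\<close>)
  qed
  also have "\<dots> = 2 * integral {0..1} (\<lambda>x. (g x - cl K (g x))\<^sup>2) + 2 * integral {0..1} (F n)"
    using int1[of k] Fint[of n]
    by (subst Henstock_Kurzweil_Integration.integral_add) (auto simp: K_def)
  also have "\<dots> \<le> e" using k n by (simp add: K_def)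
  finally show ?thesis using that[OF phi] by blast
qed

section \<open>Reduction to a sum over cells\<close>

definition cell :: "nat \<Rightarrow> nat \<Rightarrow> real set" where
  "cell n k = {real k / real n..(real k + 1) / real n}"

text \<open>A function in \<open>PC n\<close> enters the energy only through its \<open>n\<close>
  cell values. In this form the infimum runs over unrestricted sequences, whose entries from index
  \<open>n\<close> on do not matter.\<close>

definition discrete_energy :: "nat \<Rightarrow> real \<Rightarrow> (real \<Rightarrow> real) \<Rightarrow> (nat \<Rightarrow> real) \<Rightarrow> real" where
  "discrete_energy n \<beta> f U =
     (\<Sum>k<n - 1. ln (1 + (real n * (U (Suc k) - U k))\<^sup>2)) / real n
     + \<beta> * (\<Sum>k<n. integral (cell n k) (\<lambda>x. (U k - f x)\<^sup>2))"

lemma cell_subset: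
  assumes "k < n"
  shows "cell n k \<subseteq> {0..1}"
proof -
  have "(real k + 1) / real n \<le> 1" "0 \<le> real k / real n" using assms by auto
  then show ?thesis unfolding cell_def by (meson atLeastatMost_subset_iff)
qed

lemma continuous_on_cell_integrable:
  fixes h :: "real \<Rightarrow> real"
  assumes "continuous_on {0..1} h" "k < n"
  shows "h integrable_on cell n k"
  unfolding cell_def
  by (intro integrable_continuous_real continuous_on_subset[OF assms(1)])
    (use cell_subset[OF assms(2)] in \<open>simp add: cell_def\<close>)

text \<open>For \<open>k < n - 1\<close> a shift by 1/n carries cell \<open>k\<close> into cell
  \<open>Suc k\<close>, so both integrands are given by cell values. The value of \<open>u\<close>
  at 1 concerns a single point and affects neither integral.\<close>

lemma energy_eq_discrete:
  assumes "n > 0" and f: "continuous_on {0..1} f" and u: "u \<in> PC n"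
  shows "energy n \<beta> f u = discrete_energy n \<beta> f (\<lambda>k. u (real k / real n))"
proof -
  have uc: "u x = u (real k / real n)"
    if "k < n" "x \<in> {real k / real n..<(real k + 1) / real n}" for k x
    using u that unfolding PC_def by blast
  let ?U = "\<lambda>k. u (real k / real n)"
  have 1: "((\<lambda>x. ln (1 + ((u (x + 1 / real n) - u x) / (1 / real n))^2)) has_integral
     (\<Sum>k<n - 1. integral {real k / real n..(real k + 1) / real n}
        (\<lambda>x. ln (1 + (real n * (?U (Suc k) - ?U k))\<^sup>2)))) {0..real (n - 1) / real n}"
  proof (rule has_integral_cells[OF \<open>n > 0\<close>])
    fix k x assume k: "k < n - 1" and x: "x \<in> {real k / real n..<(real k + 1) / real n}"
    have "u x = ?U k" using k x by (intro uc) auto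
    moreover have "u (x + 1 / real n) = ?U (Suc k)"
      using k x by (intro uc) (auto simp: add_divide_distrib)
    ultimately show "ln (1 + ((u (x + 1 / real n) - u x) / (1 / real n))^2)
      = ln (1 + (real n * (?U (Suc k) - ?U k))\<^sup>2)" by (simp add: mult.commute)
  qed auto
  have 2: "((\<lambda>x. (u x - f x)\<^sup>2) has_integral
     (\<Sum>k<n. integral {real k / real n..(real k + 1) / real n} (\<lambda>x. (?U k - f x)\<^sup>2)))
     {0..real n / real n}"
  proof (rule has_integral_cells[OF \<open>n > 0\<close>])
    fix k assume "k < n"
    have "continuous_on {0..1} (\<lambda>x. (?U k - f x)\<^sup>2)" by (intro continuous_intros f)
    from continuous_on_cell_integrable[OF this \<open>k < n\<close>]
    show "(\<lambda>x. (?U k - f x)\<^sup>2) integrable_on {real k / real n..(real k + 1) / real n}"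
      unfolding cell_def .
  next
    fix k x assume "k < n" "x \<in> {real k / real n..<(real k + 1) / real n}"
    then have "u x = ?U k" by (rule uc)
    then show "(u x - f x)\<^sup>2 = (?U k - f x)\<^sup>2" by (rule arg_cong)
  qed
  have 3: "integral {real k / real n..(real k + 1) / real n}
        (\<lambda>x. ln (1 + (real n * (?U (Suc k) - ?U k))\<^sup>2)) =
      ln (1 + (real n * (?U (Suc k) - ?U k))\<^sup>2) / real n" for k
    using \<open>n > 0\<close> by (simp add: field_simps)
  have "1 - 1 / real n = real (n - 1) / real n"
    using \<open>n > 0\<close> by (simp add: field_simps of_nat_diff)
  moreover have "real n / real n = 1" using \<open>n > 0\<close> by simp
  ultimately show ?thesis
    using integral_unique[OF 1] integral_unique[OF 2]
    unfolding energy_def discrete_energy_def 3 cell_def sum_divide_distrib by presburger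
qed

lemma PC_interpolate:
  assumes "n > 0"
  obtains u where "u \<in> PC n" "\<And>k. k < n \<Longrightarrow> u (real k / real n) = U k"
proof
  \<comment> \<open>The first branch realizes the convention at the right endpoint; on [0,1) the
    floor is the index of the cell.\<close>
  define u :: "real \<Rightarrow> real" where "u x = (if x \<ge> 1 then U (n - 1) else U (nat \<lfloor>x * n\<rfloor>))" for x
  have uc: "u x = U k" if "k < n" "x \<in> {real k / real n..<(real k + 1) / real n}" for k x
  proof -
    have 1: "real k \<le> x * n" "x * n < real k + 1" using that assms by (auto simp: field_simps)
    then have "\<lfloor>x * n\<rfloor> = int k" by (simp add: floor_unique)
    moreover have "x < 1"
    proof -
      have "x * n < n" using 1 that by linarith
      then show ?thesis using assms by simp
    qed
    ultimately show ?thesis by (simp add: u_def)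
  qed
  show *: "u (real k / real n) = U k" if "k < n" for k
    using that assms by (intro uc) (auto simp: field_simps)
  have "u 1 = u (1 - 1 / real n)"
    using *[of "n - 1"] assms by (simp add: u_def field_simps of_nat_diff)
  moreover have "u x = u (real k / real n)"
    if "k < n" "x \<in> {real k / real n..<(real k + 1) / real n}" for k x
    using uc[OF that] *[OF that(1)] by (rule trans[OF _ sym])
  ultimately show "u \<in> PC n" unfolding PC_def by blast
qed

lemma discrete_energy_nonneg:
  assumes "\<beta> > 0"
  shows "discrete_energy n \<beta> f U \<ge> 0"
proof -
  \<comment> \<open>No regularity of \<open>f\<close> is assumed here: a square that is not
    integrable has integral 0 by convention.\<close>
  have "integral S (\<lambda>x. (c - f x)\<^sup>2) \<ge> 0" for c and S :: "real set"
    by (cases "(\<lambda>x. (c - f x)\<^sup>2) integrable_on S")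
      (auto intro: integral_nonneg simp: not_integrable_integral)
  then show ?thesis
    using assms unfolding discrete_energy_def
    by (intro add_nonneg_nonneg divide_nonneg_nonneg mult_nonneg_nonneg sum_nonneg) auto
qed

lemma discrete_energy_cong:
  assumes "\<And>k. k < n \<Longrightarrow> U k = V k"
  shows "discrete_energy n \<beta> f U = discrete_energy n \<beta> f V"
  unfolding discrete_energy_def using assms by (intro arg_cong2[where f="(+)"] arg_cong2[where f="(*)"] 
    arg_cong2[where f="(/)"] sum.cong refl) auto

lemma m_min_le:
  assumes "n > 0" "\<beta> > 0" "continuous_on {0..1} f"
  shows "m_min n \<beta> f \<le> discrete_energy n \<beta> f U"
proof -
  obtain u where u: "u \<in> PC n" "\<And>k. k < n \<Longrightarrow> u (real k / real n) = U k"
    using PC_interpolate[OF assms(1)] by blast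
  have "m_min n \<beta> f \<le> energy n \<beta> f u"
    unfolding m_min_def
  proof (rule cInf_lower)
    \<comment> \<open>The infimum of a set of reals is a lower bound only if the set is bounded
      below; nonnegativity of the energy provides this.\<close>
    show "bdd_below (energy n \<beta> f ` PC n)"
      using discrete_energy_nonneg[OF \<open>\<beta> > 0\<close>] energy_eq_discrete[OF assms(1,3)]
      by (intro bdd_belowI[of _ 0]) auto
  qed (use u in auto)
  also have "\<dots> = discrete_energy n \<beta> f U"
    unfolding energy_eq_discrete[OF assms(1,3) u(1)] by (rule discrete_energy_cong) (use u in auto)
  finally show ?thesis .
qed

lemma m_min_ge:
  assumes "n > 0" "continuous_on {0..1} f" "\<And>U. c \<le> discrete_energy n \<beta> f U"
  shows "c \<le> m_min n \<beta> f"
  unfolding m_min_def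
proof (rule cInf_greatest)
  show "energy n \<beta> f ` PC n \<noteq> {}"
    using PC_interpolate[OF assms(1), of "\<lambda>_. 0"] by blast
qed (use assms energy_eq_discrete[OF assms(1,2)] in auto)

section \<open>Lower bound\<close>

text \<open>A potential \<open>H\<close> that grows by at most \<open>c\<close> on break-free intervals; it spares the enumeration
  of the steps of a competitor.\<close>
lemma sum_over_breaks:
  fixes H :: "nat \<Rightarrow> real"
  assumes "0 < n"
    and "\<And>i j. i < j \<Longrightarrow> j \<le> n \<Longrightarrow> S \<inter> {i<..<j} = {} \<Longrightarrow> H j - H i \<le> c"
  shows "H n - H 0 \<le> c * (1 + real (card (S \<inter> {0<..<n})))"
  using assms
proof (induction n rule: less_induct)
  case (less n)
  show ?case
  proof (cases "S \<inter> {0<..<n} = {}")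
    case True
    then show ?thesis using less.prems by simp
  next
    case False
    \<comment> \<open>Split at the last break: the stretch from \<open>m\<close> to \<open>n\<close>
      is free of breaks, and the induction hypothesis covers the stretch from 0 to
      \<open>m\<close>.\<close>
    define m where "m = Max (S \<inter> {0<..<n})"
    have fin: "finite (S \<inter> {0<..<n})" by simp
    have m: "m \<in> S \<inter> {0<..<n}" unfolding m_def using fin False by (rule Max_in)
    have max: "k \<le> m" if "k \<in> S \<inter> {0<..<n}" for k
      unfolding m_def using fin that by (rule Max_ge)
    have "H n - H m \<le> c" using m max by (intro less.prems) force+
    moreover have "H m - H 0 \<le> c * (1 + real (card (S \<inter> {0<..<m})))"
      using m by (intro less.IH less.prems) auto
    moreover have "S \<inter> {0<..<n} = insert m (S \<inter> {0<..<m})" using m max by force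
    then have "card (S \<inter> {0<..<n}) = Suc (card (S \<inter> {0<..<m}))" by simp
    ultimately show ?thesis by (simp add: algebra_simps)
  qed
qed

text \<open>On the piece, \<open>U k - f x\<close> is an affine function of slope \<open>-M\<close>
  plus an error whose square is at most \<open>2 * (T\<^sup>2 + (b - a) * R)\<close>. Young's
  inequality separates the two, and dropping the midpoint square from the affine integral removes
  the dependence on \<open>c\<close>.\<close>

lemma piece_fidelity_lower:
  fixes M c T \<eta> :: real
  assumes H: "H1_with_deriv f g" and n: "n > 0" "i < j" "j \<le> n" and \<eta>: "0 < \<eta>" "\<eta> \<le> 1"
    and U: "\<And>k. k \<in> {i..<j} \<Longrightarrow> \<bar>U k - c\<bar> \<le> T"
  defines "a \<equiv> real i / real n" and "b \<equiv> real j / real n"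
  defines "R \<equiv> integral {a..b} (\<lambda>x. (g x - M)\<^sup>2)"
  shows "(1 - \<eta>) * (M\<^sup>2 * (b - a)^3 / 12) - 2 / \<eta> * ((b - a) * T\<^sup>2 + (b - a)\<^sup>2 * R)
    \<le> (\<Sum>k\<in>{i..<j}. integral (cell n k) (\<lambda>x. (U k - f x)\<^sup>2))"
proof -
  define h where "h x = (1 - \<eta>) * ((c - f a) - M * (x - a))\<^sup>2 - 2 / \<eta> * (T\<^sup>2 + (b - a) * R)" for x
  have ab: "0 \<le> a" "a \<le> b" "b \<le> 1" using n by (auto simp: a_def b_def divide_right_mono)
  have "((\<lambda>x. 2 / \<eta> * (T\<^sup>2 + (b - a) * R)) has_integral 2 / \<eta> * (T\<^sup>2 + (b - a) * R) * (b - a)) {a..b}"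
    using has_integral_const_real[of "2 / \<eta> * (T\<^sup>2 + (b - a) * R)" a b] ab by (simp add: mult.commute)
  then have h: "(h has_integral (1 - \<eta>) * ((b - a) * (c - f a - M * (b - a) / 2)\<^sup>2 + M\<^sup>2 * (b - a)^3 / 12)
      - 2 / \<eta> * (T\<^sup>2 + (b - a) * R) * (b - a)) {a..b}"
    unfolding h_def by (intro has_integral_diff has_integral_mult_right affine_has_integral ab)
  have "(1 - \<eta>) * (M\<^sup>2 * (b - a)^3 / 12) - 2 / \<eta> * ((b - a) * T\<^sup>2 + (b - a)\<^sup>2 * R)
    \<le> (1 - \<eta>) * ((b - a) * (c - f a - M * (b - a) / 2)\<^sup>2 + M\<^sup>2 * (b - a)^3 / 12)
      - 2 / \<eta> * (T\<^sup>2 + (b - a) * R) * (b - a)"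
  proof -
    have "(1 - \<eta>) * (M\<^sup>2 * (b - a)^3 / 12)
      \<le> (1 - \<eta>) * ((b - a) * (c - f a - M * (b - a) / 2)\<^sup>2 + M\<^sup>2 * (b - a)^3 / 12)"
      using \<eta> ab by (intro mult_left_mono) auto
    moreover have "2 / \<eta> * ((b - a) * T\<^sup>2 + (b - a)\<^sup>2 * R) = 2 / \<eta> * (T\<^sup>2 + (b - a) * R) * (b - a)"
    proof -
      have "(b - a) * T\<^sup>2 + (b - a)\<^sup>2 * R = (T\<^sup>2 + (b - a) * R) * (b - a)"
        by (simp add: algebra_simps power2_eq_square)
      then show ?thesis by simp
    qed
    ultimately show ?thesis by linarith
  qed
  also have "\<dots> = integral {a..b} h" using h by (rule integral_unique[symmetric])
  also have "\<dots> = (\<Sum>k\<in>{i..<j}. integral (cell n k) h)"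
    unfolding cell_def a_def b_def
    by (rule integral_cells[symmetric]) (use n h in \<open>auto simp: a_def b_def\<close>)
  also have "\<dots> \<le> (\<Sum>k\<in>{i..<j}. integral (cell n k) (\<lambda>x. (U k - f x)\<^sup>2))"
  proof (intro sum_mono integral_le)
    fix k assume k: "k \<in> {i..<j}"
    then have kn: "k < n" using n by auto
    show "h integrable_on cell n k"
      unfolding h_def by (intro continuous_on_cell_integrable[OF _ kn] continuous_intros)
    show "(\<lambda>x. (U k - f x)\<^sup>2) integrable_on cell n k"
      by (intro continuous_on_cell_integrable[OF _ kn] continuous_intros H1_continuous[OF H])
    fix x assume x: "x \<in> cell n k"
    have "a \<le> real k / real n" "(real k + 1) / real n \<le> b"
      using k by (auto simp: a_def b_def intro!: divide_right_mono)
    then have xab: "x \<in> {a..b}" using x by (auto simp: cell_def)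
    define A B where "A = (c - f a) - M * (x - a)" and "B = (U k - c) - (f x - f a - M * (x - a))"
    have B: "B\<^sup>2 \<le> 2 * (T\<^sup>2 + (b - a) * R)"
    proof -
      have "(U k - c)\<^sup>2 \<le> T\<^sup>2" using U[OF k] by (intro abs_le_square_iff[THEN iffD1]) auto
      moreover have "(f x - f a - M * (x - a))\<^sup>2 \<le> (b - a) * R"
        unfolding R_def using xab ab by (intro H1_remainder[OF H]) auto
      moreover have "(p - q)\<^sup>2 \<le> 2 * p\<^sup>2 + 2 * q\<^sup>2" for p q :: real
        using zero_le_power2[of "p + q"] unfolding power2_sum power2_diff by linarith
      from this[of "U k - c" "f x - f a - M * (x - a)"]
      have "B\<^sup>2 \<le> 2 * (U k - c)\<^sup>2 + 2 * (f x - f a - M * (x - a))\<^sup>2" by (simp only: B_def)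
      moreover have "2 * (T\<^sup>2 + (b - a) * R) = 2 * T\<^sup>2 + 2 * ((b - a) * R)" by simp
      ultimately show ?thesis by linarith
    qed
    have "h x = (1 - \<eta>) * A\<^sup>2 - 2 * (T\<^sup>2 + (b - a) * R) / \<eta>" by (simp add: h_def A_def)
    also have "\<dots> \<le> (1 - \<eta>) * A\<^sup>2 - B\<^sup>2 / \<eta>" using B \<eta> by (intro diff_left_mono divide_right_mono) auto
    also have "\<dots> \<le> (A + B)\<^sup>2" using \<eta>(1) by (rule sq_add_lower)
    also have "A + B = U k - f x" by (simp add: A_def B_def)
    finally show "h x \<le> (U k - f x)\<^sup>2" .
  qed
  finally show ?thesis .
qed

text \<open>The bound \<open>powr_two_thirds_le\<close>, integrated with the roles of
  \<open>g\<close> and \<open>M\<close> in both orders. The first form serves the lower bound for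
  the energy, the second the upper bound.\<close>

lemma integral_powr_two_thirds_le:
  assumes H: "H1_with_deriv f g" and ab: "0 \<le> a" "a \<le> b" "b \<le> 1" and "\<kappa> > 0"
  shows "integral {a..b} (\<lambda>x. \<bar>g x\<bar> powr (2/3))
    \<le> (b - a) * \<bar>M\<bar> powr (2/3) + \<kappa> * (b - a) + integral {a..b} (\<lambda>x. (g x - M)\<^sup>2) / \<kappa>\<^sup>2"
    and "(b - a) * \<bar>M\<bar> powr (2/3)
    \<le> integral {a..b} (\<lambda>x. \<bar>g x\<bar> powr (2/3)) + \<kappa> * (b - a) + integral {a..b} (\<lambda>x. (g x - M)\<^sup>2) / \<kappa>\<^sup>2"
proof -
  have i: "(\<lambda>x. \<bar>g x\<bar> powr (2/3)) integrable_on {a..b}" "(\<lambda>x. (g x - M)\<^sup>2) integrable_on {a..b}"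
    using H1_integrable[OF H, of "\<lambda>_. M"] ab by (auto elim!: integrable_on_subinterval)
  have c: "((\<lambda>x. c) has_integral c * (b - a)) {a..b}" for c :: real
    using has_integral_const_real[of c a b] ab by (simp add: mult.commute)
  note I = has_integral_add[OF has_integral_add[OF _ c] has_integral_divide[OF integrable_integral[OF i(2)]]]
  show "integral {a..b} (\<lambda>x. \<bar>g x\<bar> powr (2/3))
    \<le> (b - a) * \<bar>M\<bar> powr (2/3) + \<kappa> * (b - a) + integral {a..b} (\<lambda>x. (g x - M)\<^sup>2) / \<kappa>\<^sup>2"
    using has_integral_le[OF integrable_integral[OF i(1)] I[OF c, of "\<bar>M\<bar> powr (2/3)" \<kappa> "\<kappa>\<^sup>2"]]
      powr_two_thirds_le[OF \<open>\<kappa> > 0\<close>, of "g _" M] by (simp add: mult.commute)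
  show "(b - a) * \<bar>M\<bar> powr (2/3)
    \<le> integral {a..b} (\<lambda>x. \<bar>g x\<bar> powr (2/3)) + \<kappa> * (b - a) + integral {a..b} (\<lambda>x. (g x - M)\<^sup>2) / \<kappa>\<^sup>2"
    using has_integral_le[OF c[of "\<bar>M\<bar> powr (2/3)"] I[OF integrable_integral[OF i(1)], of \<kappa> "\<kappa>\<^sup>2"]]
      powr_two_thirds_le[OF \<open>\<kappa> > 0\<close>, of M "g _"] by (simp add: mult.commute power2_commute)
qed

text \<open>\<open>T\<close> bounds the variation of \<open>U\<close> on the piece. If it exceeds \<open>\<kappa> w\<close> then the term with \<open>\<Phi>\<close> makes
  the inequality trivial, and such pieces are few because the variations are summable.\<close>
lemma piece_lower:
  fixes M c T \<eta> L \<kappa> \<Phi> w \<beta> :: real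
  assumes H: "H1_with_deriv f g" and n: "n > 0" "i < j" "j \<le> n" and \<eta>: "0 < \<eta>" "\<eta> \<le> 1"
    and U: "\<And>k. k \<in> {i..<j} \<Longrightarrow> \<bar>U k - c\<bar> \<le> T"
    and pos: "\<beta> > 0" "\<kappa> > 0" "w > 0" "L > 0" "T \<ge> 0" and \<Phi>: "\<bar>M\<bar> powr (2/3) \<le> \<Phi>"
  defines "a \<equiv> real i / real n" and "b \<equiv> real j / real n"
  assumes d: "b - a \<le> L * w"
  defines "R \<equiv> integral {a..b} (\<lambda>x. (g x - M)\<^sup>2)" and "B \<equiv> \<beta> powr (1/3)"
  shows "(1 - \<eta>) * w\<^sup>2 * B * integral {a..b} (\<lambda>x. \<bar>g x\<bar> powr (2/3))
     - w\<^sup>2 * ((2 * \<beta> * \<kappa>\<^sup>2 / \<eta> + \<kappa> * B) * (b - a) + (2 * \<beta> * L\<^sup>2 / \<eta> + B / \<kappa>\<^sup>2) * R + L * B * \<Phi> / \<kappa> * T)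
     - \<beta> * (\<Sum>k\<in>{i..<j}. integral (cell n k) (\<lambda>x. (U k - f x)\<^sup>2)) \<le> 4 / 3 * w^3"
proof -
  let ?F = "\<Sum>k\<in>{i..<j}. integral (cell n k) (\<lambda>x. (U k - f x)\<^sup>2)"
  let ?m = "\<bar>M\<bar> powr (2/3)"
  have ab: "0 \<le> a" "a \<le> b" "b \<le> 1" using n by (auto simp: a_def b_def divide_right_mono)
  have R: "R \<ge> 0"
    unfolding R_def using H1_integrable(2)[OF H, of "\<lambda>_. M"] ab
    by (intro integral_nonneg) (auto elim!: integrable_on_subinterval)
  have B: "B > 0" "B^3 = \<beta>" using pos real_cube_root[of \<beta>] by (auto simp: B_def)
  have F: "?F \<ge> 0"
  proof (intro sum_nonneg integral_nonneg)
    fix k assume "k \<in> {i..<j}"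
    then have "k < n" using n by auto
    then show "(\<lambda>x. (U k - f x)\<^sup>2) integrable_on cell n k"
      by (intro continuous_on_cell_integrable continuous_intros H1_continuous[OF H])
  qed auto
  have "(1 - \<eta>) * w\<^sup>2 * B * integral {a..b} (\<lambda>x. \<bar>g x\<bar> powr (2/3))
    \<le> (1 - \<eta>) * w\<^sup>2 * B * ((b - a) * ?m + (\<kappa> * (b - a) + R / \<kappa>\<^sup>2))"
    using integral_powr_two_thirds_le(1)[OF H ab pos(2), of M] \<eta> pos B
    by (intro mult_left_mono) (auto simp: R_def)
  also have "\<dots> = (1 - \<eta>) * (w\<^sup>2 * (b - a) * (B * ?m)) + (1 - \<eta>) * (w\<^sup>2 * B * (\<kappa> * (b - a) + R / \<kappa>\<^sup>2))"
    by (simp only: distrib_left mult_ac)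
  also have "(1 - \<eta>) * (w\<^sup>2 * B * (\<kappa> * (b - a) + R / \<kappa>\<^sup>2)) \<le> 1 * (w\<^sup>2 * B * (\<kappa> * (b - a) + R / \<kappa>\<^sup>2))"
    using \<eta> pos B R ab by (intro mult_right_mono) auto
  finally have 1: "(1 - \<eta>) * w\<^sup>2 * B * integral {a..b} (\<lambda>x. \<bar>g x\<bar> powr (2/3))
    \<le> (1 - \<eta>) * (w\<^sup>2 * (b - a) * (B * ?m)) + w\<^sup>2 * B * (\<kappa> * (b - a) + R / \<kappa>\<^sup>2)" by simp
  have 2: "(1 - \<eta>) * (w\<^sup>2 * (b - a) * (B * ?m)) \<le> 4 / 3 * w^3 + \<beta> * ?F
    + w\<^sup>2 * (2 * \<beta> * \<kappa>\<^sup>2 / \<eta> * (b - a) + 2 * \<beta> * L\<^sup>2 / \<eta> * R + L * B * \<Phi> / \<kappa> * T)"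
  proof (cases "T \<le> \<kappa> * w")
    case True
    \<comment> \<open>With \<open>z = B * ?m\<close> in \<open>square_cube_amgm\<close> the cube of
      \<open>z\<close> is \<open>\<beta> * M\<^sup>2\<close>, the coefficient of the affine
      fidelity.\<close>
    have m3: "?m ^ 3 = M\<^sup>2"
      by (cases "M = 0") (auto simp: powr_power powr_numeral)
    have "(1 - \<eta>) * (w\<^sup>2 * (b - a) * (B * ?m)) \<le> (1 - \<eta>) * (4/3 * w^3 + (B * ?m)^3 * (b - a)^3 / 12)"
      using pos ab B \<eta> by (intro mult_left_mono square_cube_amgm) auto
    also have "\<dots> = (1 - \<eta>) * (4/3 * w^3) + \<beta> * ((1 - \<eta>) * (M\<^sup>2 * (b - a)^3 / 12))"
      by (simp add: power_mult_distrib m3 B algebra_simps)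
    also have "(1 - \<eta>) * (4/3 * w^3) \<le> 1 * (4/3 * w^3)"
      using \<eta> pos by (intro mult_right_mono) auto
    also have "\<beta> * ((1 - \<eta>) * (M\<^sup>2 * (b - a)^3 / 12))
      \<le> \<beta> * (?F + 2 / \<eta> * ((b - a) * T\<^sup>2 + (b - a)\<^sup>2 * R))"
    proof (intro mult_left_mono)
      have "(1 - \<eta>) * (M\<^sup>2 * (b - a)^3 / 12) - 2 / \<eta> * ((b - a) * T\<^sup>2 + (b - a)\<^sup>2 * R) \<le> ?F"
        unfolding a_def b_def R_def by (rule piece_fidelity_lower[OF H n \<eta> U])
      then show "(1 - \<eta>) * (M\<^sup>2 * (b - a)^3 / 12)
        \<le> ?F + 2 / \<eta> * ((b - a) * T\<^sup>2 + (b - a)\<^sup>2 * R)" by linarith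
    qed (use pos in auto)
    also have "\<dots> \<le> \<beta> * (?F + 2 / \<eta> * ((b - a) * (\<kappa> * w)\<^sup>2 + (L * w)\<^sup>2 * R))"
      using True pos ab R d \<eta>
      by (intro mult_left_mono add_left_mono add_mono mult_right_mono power_mono) auto
    also have "\<dots> = \<beta> * ?F + w\<^sup>2 * (2 * \<beta> * \<kappa>\<^sup>2 / \<eta> * (b - a) + 2 * \<beta> * L\<^sup>2 / \<eta> * R)"
    proof -
      have "\<beta> * (F + 2 / \<eta> * (D * (\<kappa> * w)\<^sup>2 + (L * w)\<^sup>2 * R))
        = \<beta> * F + w\<^sup>2 * (2 * \<beta> * \<kappa>\<^sup>2 / \<eta> * D + 2 * \<beta> * L\<^sup>2 / \<eta> * R)" for F D
        by (simp add: power_mult_distrib algebra_simps)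
      then show ?thesis .
    qed
    also have "\<dots> \<le> \<beta> * ?F + w\<^sup>2 * (2 * \<beta> * \<kappa>\<^sup>2 / \<eta> * (b - a) + 2 * \<beta> * L\<^sup>2 / \<eta> * R + L * B * \<Phi> / \<kappa> * T)"
      using pos B order_trans[OF _ \<Phi>] by (intro add_left_mono mult_left_mono) auto
    finally show ?thesis by simp
  next
    case False
    have \<Phi>0: "\<Phi> \<ge> 0" using order_trans[OF _ \<Phi>] by auto
    have "(1 - \<eta>) * (w\<^sup>2 * (b - a) * (B * ?m)) \<le> 1 * (w\<^sup>2 * (L * w) * (B * \<Phi>))"
      using \<eta> pos ab B d \<Phi> \<Phi>0 by (intro mult_mono mult_left_mono) auto
    also have "\<dots> = w\<^sup>2 * (L * B * \<Phi> * w)" by simp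
    also have "\<dots> \<le> w\<^sup>2 * (L * B * \<Phi> * (T / \<kappa>))"
      using False pos B \<Phi>0 by (intro mult_left_mono) (auto simp: field_simps)
    also have "\<dots> = w\<^sup>2 * (L * B * \<Phi> / \<kappa> * T)" by simp
    also have "\<dots> \<le> w\<^sup>2 * (2 * \<beta> * \<kappa>\<^sup>2 / \<eta> * (b - a) + 2 * \<beta> * L\<^sup>2 / \<eta> * R + L * B * \<Phi> / \<kappa> * T)"
      using pos \<eta> R ab by (intro mult_left_mono) auto
    finally have "(1 - \<eta>) * (w\<^sup>2 * (b - a) * (B * ?m)) \<le>
      w\<^sup>2 * (2 * \<beta> * \<kappa>\<^sup>2 / \<eta> * (b - a) + 2 * \<beta> * L\<^sup>2 / \<eta> * R + L * B * \<Phi> / \<kappa> * T)" .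
    moreover have "0 \<le> 4 / 3 * w^3" "0 \<le> \<beta> * ?F" using pos F by auto
    ultimately show ?thesis by linarith
  qed
  have "w\<^sup>2 * ((p + \<kappa> * B) * D + (q + B / \<kappa>\<^sup>2) * R + r)
    = w\<^sup>2 * (p * D + q * R + r) + w\<^sup>2 * B * (\<kappa> * D + R / \<kappa>\<^sup>2)" for p q r D
    by (simp add: algebra_simps)
  from this[of "2 * \<beta> * \<kappa>\<^sup>2 / \<eta>" "b - a" "2 * \<beta> * L\<^sup>2 / \<eta>" "L * B * \<Phi> / \<kappa> * T"] 1 2
  show ?thesis by linarith
qed

section \<open>Artificial breaks at the multiples of \<open>q\<close>\<close>

lemma card_multiples_le:
  fixes n q :: nat
  assumes "q > 0"
  shows "real (card {k \<in> {0<..<n}. q dvd k}) \<le> real n / real q"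
proof -
  have "card {k \<in> {0<..<n}. q dvd k} \<le> card {1..n div q}"
    by (rule card_inj_on_le[where f="\<lambda>k. k div q"])
      (use assms in \<open>auto simp: inj_on_def less_eq_div_iff_mult_less_eq mult.commute elim!: dvdE\<close>)
  then have "real (card {k \<in> {0<..<n}. q dvd k}) \<le> real (n div q)" by simp
  also have "\<dots> \<le> real n / real q" by (rule of_nat_div_le_of_nat)
  finally show ?thesis .
qed

lemma multiple_between:
  fixes i j q :: nat
  assumes "q > 0" "q < j - i"
  obtains k where "k \<in> {i<..<j}" "q dvd k"
proof
  show "q dvd q * (i div q + 1)" by simp
  have "i < q * (i div q + 1)"
    using assms by (metis Suc_eq_plus1 dividend_less_times_div mult_Suc_right)
  moreover have "q * (i div q) \<le> i" "q * (i div q + 1) = q * (i div q) + q" by simp_all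
  then have "q * (i div q + 1) < j" using assms by linarith
  ultimately show "q * (i div q + 1) \<in> {i<..<j}" by simp
qed

lemma fidelity_nonneg:
  fixes f :: "real \<Rightarrow> real"
  assumes "continuous_on {0..1} f" "k < n"
  shows "0 \<le> integral (cell n k) (\<lambda>x. (c - f x)\<^sup>2)"
  by (intro integral_nonneg continuous_on_cell_integrable[OF _ assms(2)] continuous_intros assms(1)) auto

text \<open>The multiples of \<open>q\<close> are added to the big jumps as artificial breaks, so that every piece has length
  at most \<open>L w\<close>; they cost only \<open>O(w\<^sup>2 / L)\<close>.\<close>
lemma discrete_energy_lower:
  fixes U :: "nat \<Rightarrow> real" and \<phi> :: "real \<Rightarrow> real" and \<beta> \<eta> \<kappa> \<theta> L \<rho> \<Phi> :: real and n q :: nat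
  assumes H: "H1_with_deriv f g" and n: "n \<ge> 2" and \<eta>: "0 < \<eta>" "\<eta> \<le> 1" and \<theta>: "0 < \<theta>" "\<theta> \<le> 1"
    and pos: "\<beta> > 0" "\<kappa> > 0" "w > 0" "L > 0" and q: "q > 0" "real q / real n \<le> L * w"
    and w3: "w^3 = ln (real n) / real n"
    and \<phi>: "continuous_on {0..1} \<phi>" and \<Phi>: "\<And>x. x \<in> {0..1} \<Longrightarrow> \<bar>\<phi> x\<bar> powr (2/3) \<le> \<Phi>"
    and \<rho>: "\<And>x y. x \<in> {0..1} \<Longrightarrow> y \<in> {0..1} \<Longrightarrow> \<bar>x - y\<bar> \<le> L * w \<Longrightarrow> \<bar>\<phi> x - \<phi> y\<bar> \<le> \<rho>"
  defines "B \<equiv> \<beta> powr (1/3)" and "Y \<equiv> real n powr (2 * \<theta> / 3)"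
    and "D \<equiv> discrete_energy n \<beta> f U"
  shows "w\<^sup>2 * ((1 - \<eta>) * B * integral {0..1} (\<lambda>x. \<bar>g x\<bar> powr (2/3))
      - (2 * \<beta> * \<kappa>\<^sup>2 / \<eta> + \<kappa> * B)
      - (2 * \<beta> * L\<^sup>2 / \<eta> + B / \<kappa>\<^sup>2) * integral {0..1} (\<lambda>x. (\<bar>g x - \<phi> x\<bar> + \<rho>)\<^sup>2)
      - L * B * \<Phi> / \<kappa> * (1 / Y + 2 * Y * D))
      - 4 / 3 * w^3 * (1 + real n / real q) \<le> D / \<theta>"
proof -
  define y where "y k = real n * \<bar>U k - U (k - 1)\<bar>" for k
  \<comment> \<open>Since \<open>Y\<^sup>2\<close> is \<open>n\<close> to the power
    \<open>4 / 3 * \<theta>\<close>, each of these increments costs at least \<open>\<theta>\<close>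
    times the ideal amount \<open>4 / 3 * w^3\<close>. This is the source of the division by
    \<open>\<theta>\<close>.\<close>
  define big where "big = {k \<in> {0<..<n}. Y < y k}"
  define S where "S = big \<union> {k \<in> {0<..<n}. q dvd k}"
  \<comment> \<open>These are the increments that \<open>ln_ge_small_jump\<close> controls. Inside a
    break-free piece every increment is of this kind.\<close>
  define \<tau> where "\<tau> k = (if k \<in> {0<..<n} - big then \<bar>U k - U (k - 1)\<bar> else 0)" for k
  define P where "P = (\<Sum>k\<in>{0<..<n}. ln (1 + (y k)\<^sup>2)) / real n"
  define fid where "fid k = integral (cell n k) (\<lambda>x. (U k - f x)\<^sup>2)" for k
  define C1 C2 C3 where "C1 = 2 * \<beta> * \<kappa>\<^sup>2 / \<eta> + \<kappa> * B" and "C2 = 2 * \<beta> * L\<^sup>2 / \<eta> + B / \<kappa>\<^sup>2"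
    and "C3 = L * B * \<Phi> / \<kappa>"
  let ?G = "\<lambda>x. \<bar>g x\<bar> powr (2/3)" and ?E = "\<lambda>x. (\<bar>g x - \<phi> x\<bar> + \<rho>)\<^sup>2"
  \<comment> \<open>The potential for \<open>sum_over_breaks\<close>: main term minus errors minus
    fidelity, accumulated over the first \<open>j\<close> cells. All terms are additive, so
    \<open>piece_lower\<close> bounds the increments over break-free pieces.\<close>
  define Hf where "Hf j = (1 - \<eta>) * w\<^sup>2 * B * integral {0..real j / real n} ?G
    - w\<^sup>2 * (C1 * (real j / real n) + C2 * integral {0..real j / real n} ?E + C3 * (\<Sum>k<j. \<tau> k))
    - \<beta> * (\<Sum>k<j. fid k)" for j :: nat
  have fc: "continuous_on {0..1} f" by (rule H1_continuous[OF H])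
  have n0: "n > 0" using n by simp
  have Y1: "Y \<ge> 1" unfolding Y_def using n \<theta> by (intro ge_one_powr_ge_zero) auto
  have B0: "B \<ge> 0" by (simp add: B_def)
  have \<Phi>0: "\<Phi> \<ge> 0" using order_trans[OF _ \<Phi>[of 0]] by auto
  have C: "C2 \<ge> 0" "C3 \<ge> 0" using pos \<eta> B0 \<Phi>0 by (auto simp: C2_def C3_def)
  have fid0: "fid k \<ge> 0" if "k < n" for k
    unfolding fid_def by (rule fidelity_nonneg[OF fc that])
  have D: "D = P + \<beta> * (\<Sum>k<n. fid k)"
  proof -
    have "{0<..<n} = Suc ` {..<n - 1}"
      by (auto simp: image_Suc_lessThan)
    then have "(\<Sum>k\<in>{0<..<n}. ln (1 + (y k)\<^sup>2)) = (\<Sum>k<n - 1. ln (1 + (y (Suc k))\<^sup>2))"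
      by (simp add: sum.reindex)
    then show ?thesis
      by (simp add: D_def P_def discrete_energy_def fid_def y_def power_mult_distrib)
  qed
  have F0: "0 \<le> \<beta> * (\<Sum>k<n. fid k)" using pos fid0 by (intro mult_nonneg_nonneg sum_nonneg) auto
  have PD: "P \<le> D" using D F0 by simp
  have Tsum: "(\<Sum>k<n. \<tau> k) \<le> 1 / Y + 2 * Y * D"
  proof -
    have "(\<Sum>k<n. \<tau> k) = (\<Sum>k\<in>{0<..<n}. \<tau> k)"
      by (rule sum.mono_neutral_right) (auto simp: \<tau>_def)
    also have "\<dots> \<le> (\<Sum>k\<in>{0<..<n}. (1 / Y + 2 * Y * ln (1 + (y k)\<^sup>2)) / real n)"
    proof (rule sum_mono)
      fix k assume k: "k \<in> {0<..<n}"
      show "\<tau> k \<le> (1 / Y + 2 * Y * ln (1 + (y k)\<^sup>2)) / real n"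
      proof (cases "k \<in> big")
        case True
        then show ?thesis using Y1 by (simp add: \<tau>_def)
      next
        case False
        then have "y k \<le> 1 / Y + 2 * Y * ln (1 + (y k)\<^sup>2)"
          using k by (intro ln_ge_small_jump[OF Y1]) (auto simp: y_def big_def)
        then show ?thesis using False k n0 by (simp add: \<tau>_def y_def field_simps)
      qed
    qed
    also have "\<dots> = real (n - 1) / real n * (1 / Y) + 2 * Y * P"
      by (simp add: P_def sum.distrib sum_distrib_left add_divide_distrib sum_divide_distrib)
    also have "\<dots> \<le> 1 * (1 / Y) + 2 * Y * D"
      using Y1 PD n by (intro add_mono mult_right_mono mult_left_mono) auto
    finally show ?thesis by simp
  qed
  have bigP: "4 / 3 * w^3 * real (card big) \<le> P / \<theta>"
  proof -
    have "4 / 3 * \<theta> * ln (real n) \<le> ln (1 + (y k)\<^sup>2)" if "k \<in> big" for k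
    proof -
      have "Y\<^sup>2 \<le> (y k)\<^sup>2" using that Y1 by (intro power_mono) (auto simp: big_def)
      then have le: "Y\<^sup>2 \<le> 1 + (y k)\<^sup>2" by simp
      have "4 / 3 * \<theta> * ln (real n) = ln (Y\<^sup>2)"
        using n0 by (simp add: Y_def ln_realpow ln_powr)
      also have "\<dots> \<le> ln (1 + (y k)\<^sup>2)" using Y1 le by (intro ln_mono) auto
      finally show ?thesis .
    qed
    then have "(\<Sum>k\<in>big. 4 / 3 * \<theta> * ln (real n)) \<le> (\<Sum>k\<in>big. ln (1 + (y k)\<^sup>2))"
      by (rule sum_mono)
    also have "\<dots> \<le> (\<Sum>k\<in>{0<..<n}. ln (1 + (y k)\<^sup>2))"
      by (rule sum_mono2) (auto simp: big_def)
    finally have "real (card big) * (4 / 3 * \<theta> * ln (real n)) \<le> (\<Sum>k\<in>{0<..<n}. ln (1 + (y k)\<^sup>2))"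
      by (simp only: sum_constant)
    then have "real (card big) * (4 / 3 * \<theta> * ln (real n)) / real n \<le> P"
      unfolding P_def by (rule divide_right_mono) simp
    then show ?thesis using \<theta> by (simp add: w3 field_simps)
  qed
  have "Hf n - Hf 0 \<le> 4 / 3 * w^3 * (1 + real (card (S \<inter> {0<..<n})))"
  proof (rule sum_over_breaks)
    fix i j :: nat
    assume ij: "i < j" "j \<le> n" and nobreak: "S \<inter> {i<..<j} = {}"
    define a b where "a = real i / real n" and "b = real j / real n"
    define M where "M = \<phi> a"
    define T where "T = (\<Sum>k\<in>{i..<j}. \<tau> k)"
    define R where "R = integral {a..b} (\<lambda>x. (g x - M)\<^sup>2)"
    have ab: "0 \<le> a" "a \<le> b" "b \<le> 1" using ij n0 by (auto simp: a_def b_def divide_right_mono)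
    \<comment> \<open>A longer piece would contain a multiple of \<open>q\<close> in its interior,
      which is a break.\<close>
    have "j - i \<le> q"
    proof (rule ccontr)
      assume "\<not> j - i \<le> q"
      then have "q < j - i" by simp
      then obtain k where "k \<in> {i<..<j}" "q dvd k" by (rule multiple_between[OF q(1)])
      then have "k \<in> S \<inter> {i<..<j}" unfolding S_def using ij by simp
      then show False using nobreak by blast
    qed
    then have "real j - real i \<le> real q" using ij by linarith
    then have "b - a \<le> real q / real n"
      using n0 by (simp add: a_def b_def divide_right_mono flip: diff_divide_distrib)
    then have d: "b - a \<le> L * w" using q(2) by linarith
    have \<tau>0: "\<tau> k \<ge> 0" for k by (simp add: \<tau>_def)
    \<comment> \<open>The increment into the piece, \<open>\<tau> i\<close>, is included although
      only the later ones occur here. It is nonnegative, and with it the quantities \<open>T\<close>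
      of consecutive pieces add up.\<close>
    have U: "\<bar>U k - U i\<bar> \<le> T" if "k \<in> {i..<j}" for k
    proof -
      have "i \<le> k" "k < j" using that by auto
      then have "\<bar>U k - U i\<bar> \<le> (\<Sum>l\<in>{i..k}. \<tau> l)"
      proof (induction k rule: dec_induct)
        case base
        then show ?case using \<tau>0 by simp
      next
        case (step k)
        have "Suc k \<in> {i<..<j}" using step by simp
        then have "Suc k \<notin> big" using nobreak unfolding S_def by blast
        then have "\<tau> (Suc k) = \<bar>U (Suc k) - U k\<bar>" using step ij by (simp add: \<tau>_def)
        moreover have "(\<Sum>l\<in>{i..Suc k}. \<tau> l) = (\<Sum>l\<in>{i..k}. \<tau> l) + \<tau> (Suc k)"
          using step by simp
        moreover have "\<bar>U k - U i\<bar> \<le> (\<Sum>l\<in>{i..k}. \<tau> l)" using step by simp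
        ultimately show ?case by linarith
      qed
      also have "\<dots> \<le> T" unfolding T_def using that by (intro sum_mono2) (auto simp: \<tau>0)
      finally show ?thesis .
    qed
    have T0: "T \<ge> 0" unfolding T_def by (intro sum_nonneg \<tau>0)
    have "\<bar>M\<bar> powr (2/3) \<le> \<Phi>" unfolding M_def using ab by (intro \<Phi>) auto
    from piece_lower[OF H n0 ij \<eta> U pos T0 this] d
    have main: "(1 - \<eta>) * w\<^sup>2 * B * integral {a..b} ?G - w\<^sup>2 * (C1 * (b - a) + C2 * R + C3 * T)
      - \<beta> * (\<Sum>k\<in>{i..<j}. fid k) \<le> 4 / 3 * w^3"
      unfolding C1_def C2_def C3_def B_def R_def a_def b_def fid_def by simp
    have sub: "h integrable_on {a..b}" "h integrable_on {0..b}" if "h integrable_on {0..1}" for h :: "real \<Rightarrow> real"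
      using that ab by (auto elim!: integrable_on_subinterval)
    have I: "integral {0..b} h = integral {0..a} h + integral {a..b} h" if "h integrable_on {0..1}"
      for h :: "real \<Rightarrow> real"
      using Henstock_Kurzweil_Integration.integral_combine[OF _ _ sub(2)[OF that], of a] ab by simp
    note gi = H1_integrable[OF H \<phi>]
    \<comment> \<open>Replaces the slope chosen on each piece by one integrand common to all pieces,
      so that the errors add up to a single integral over [0,1].\<close>
    have RE: "R \<le> integral {a..b} ?E"
      unfolding R_def
    proof (rule integral_le)
      show "(\<lambda>x. (g x - M)\<^sup>2) integrable_on {a..b}"
        by (intro sub H1_integrable[OF H] continuous_intros)
      show "?E integrable_on {a..b}" by (intro sub gi)
      fix x assume x: "x \<in> {a..b}"
      have "\<bar>\<phi> x - \<phi> a\<bar> \<le> \<rho>" using x ab d by (intro \<rho>) auto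
      then show "(g x - M)\<^sup>2 \<le> ?E x"
        unfolding M_def by (intro abs_le_square_iff[THEN iffD1]) auto
    qed
    have S: "(\<Sum>k<j. h k) = (\<Sum>k<i. h k) + (\<Sum>k\<in>{i..<j}. h k)" for h :: "nat \<Rightarrow> real"
      using ij sum.atLeastLessThan_concat[of 0 i j h] by (simp add: lessThan_atLeast0)
    have "Hf j - Hf i = (1 - \<eta>) * w\<^sup>2 * B * integral {a..b} ?G
      - w\<^sup>2 * (C1 * (b - a) + C2 * integral {a..b} ?E + C3 * T) - \<beta> * (\<Sum>k\<in>{i..<j}. fid k)"
      unfolding Hf_def a_def[symmetric] b_def[symmetric] I[OF gi(3)] I[OF gi(5)] S T_def
      by (simp add: algebra_simps)
    also have "\<dots> \<le> (1 - \<eta>) * w\<^sup>2 * B * integral {a..b} ?G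
      - w\<^sup>2 * (C1 * (b - a) + C2 * R + C3 * T) - \<beta> * (\<Sum>k\<in>{i..<j}. fid k)"
      using RE C by (intro diff_right_mono diff_left_mono mult_left_mono add_mono order_refl) auto
    also note main
    finally show "Hf j - Hf i \<le> 4 / 3 * w^3" .
  qed (use n0 in auto)
  moreover have "real (card (S \<inter> {0<..<n})) \<le> real (card big) + real n / real q"
  proof -
    have "card (S \<inter> {0<..<n}) \<le> card S" by (rule card_mono) (auto simp: S_def big_def)
    also have "\<dots> \<le> card big + card {k \<in> {0<..<n}. q dvd k}" unfolding S_def by (rule card_Un_le)
    finally show ?thesis using card_multiples_le[OF q(1), of n] by linarith
  qed
  then have "4 / 3 * w^3 * (1 + real (card (S \<inter> {0<..<n}))) \<le> 4 / 3 * w^3 * (1 + real n / real q + real (card big))"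
    using pos by (intro mult_left_mono) auto
  moreover have "4 / 3 * w^3 * (1 + real n / real q + real (card big))
      = 4 / 3 * w^3 * (1 + real n / real q) + 4 / 3 * w^3 * real (card big)"
    by (simp add: distrib_left)
  ultimately have "Hf n - Hf 0 \<le> 4 / 3 * w^3 * (1 + real n / real q) + P / \<theta>"
    using bigP by linarith
  moreover have "w\<^sup>2 * (C3 * (\<Sum>k<n. \<tau> k)) \<le> w\<^sup>2 * (C3 * (1 / Y + 2 * Y * D))"
    using Tsum C by (intro mult_left_mono) auto
  moreover have "Hf n - Hf 0 = w\<^sup>2 * ((1 - \<eta>) * B * integral {0..1} ?G - C1 - C2 * integral {0..1} ?E)
      - w\<^sup>2 * (C3 * (\<Sum>k<n. \<tau> k)) - \<beta> * (\<Sum>k<n. fid k)"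
    using n0 by (simp add: Hf_def algebra_simps)
  \<comment> \<open>Only the jump part loses the factor \<open>\<theta>\<close>. As the fidelity is
    nonnegative and \<open>\<theta> \<le> 1\<close>, dividing it as well yields a bound by the total
    energy.\<close>
  moreover have "P / \<theta> + \<beta> * (\<Sum>k<n. fid k) \<le> D / \<theta>"
  proof -
    have "\<beta> * (\<Sum>k<n. fid k) \<le> \<beta> * (\<Sum>k<n. fid k) / \<theta>"
      using \<theta> F0 mult_right_mono[OF \<theta>(2) F0] by (simp add: field_simps)
    then show ?thesis by (simp add: D add_divide_distrib)
  qed
  moreover have "w\<^sup>2 * ((1 - \<eta>) * B * integral {0..1} ?G - C1 - C2 * integral {0..1} ?E - C3 * (1 / Y + 2 * Y * D))
     = w\<^sup>2 * ((1 - \<eta>) * B * integral {0..1} ?G - C1 - C2 * integral {0..1} ?E) - w\<^sup>2 * (C3 * (1 / Y + 2 * Y * D))"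
    by (simp add: right_diff_distrib)
  ultimately have "w\<^sup>2 * ((1 - \<eta>) * B * integral {0..1} ?G - C1 - C2 * integral {0..1} ?E - C3 * (1 / Y + 2 * Y * D))
     - 4 / 3 * w^3 * (1 + real n / real q) \<le> D / \<theta>" by linarith
  then show ?thesis by (simp only: C1_def C2_def C3_def)
qed

section \<open>Upper bound\<close>

text \<open>The midpoint value cancels the first term of \<open>affine_has_integral\<close>, so only
  the variance of the affine part remains; the deviation of \<open>f\<close> from that affine part
  is bounded by \<open>H1_remainder\<close>.\<close>

lemma piece_fidelity_upper:
  fixes M \<eta> :: real
  assumes H: "H1_with_deriv f g" and n: "n > 0" "i < j" "j \<le> n" and \<eta>: "0 < \<eta>"
  defines "a \<equiv> real i / real n" and "b \<equiv> real j / real n"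
  defines "R \<equiv> integral {a..b} (\<lambda>x. (g x - M)\<^sup>2)"
  shows "(\<Sum>k\<in>{i..<j}. integral (cell n k) (\<lambda>x. (f ((a + b) / 2) - f x)\<^sup>2))
    \<le> (1 + \<eta>) * (M\<^sup>2 * (b - a)^3 / 12) + (1 + 1 / \<eta>) * ((b - a)\<^sup>2 * R)"
proof -
  define m where "m = (a + b) / 2"
  define h where "h x = (1 + \<eta>) * (M * (b - a) / 2 - M * (x - a))\<^sup>2 + (1 + 1 / \<eta>) * ((b - a) * R)" for x
  have ab: "0 \<le> a" "a \<le> b" "b \<le> 1" using n by (auto simp: a_def b_def divide_right_mono)
  have fi: "(\<lambda>x. (f m - f x)\<^sup>2) integrable_on {a..b}"
    using ab by (intro integrable_continuous_real continuous_intros continuous_on_subset[OF H1_continuous[OF H]]) auto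
  have "((\<lambda>x. (1 + 1 / \<eta>) * ((b - a) * R)) has_integral (1 + 1 / \<eta>) * ((b - a) * R) * (b - a)) {a..b}"
    using has_integral_const_real[of "(1 + 1 / \<eta>) * ((b - a) * R)" a b] ab by (simp add: mult.commute)
  then have h: "(h has_integral (1 + \<eta>) * ((b - a) * (M * (b - a) / 2 - M * (b - a) / 2)\<^sup>2 + M\<^sup>2 * (b - a)^3 / 12)
      + (1 + 1 / \<eta>) * ((b - a) * R) * (b - a)) {a..b}"
    unfolding h_def by (intro has_integral_add has_integral_mult_right affine_has_integral ab)
  have "(\<Sum>k\<in>{i..<j}. integral (cell n k) (\<lambda>x. (f m - f x)\<^sup>2)) = integral {a..b} (\<lambda>x. (f m - f x)\<^sup>2)"
    using fi n unfolding cell_def a_def b_def by (intro integral_cells) auto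
  also have "\<dots> \<le> integral {a..b} h"
  proof (rule integral_le[OF fi])
    show "h integrable_on {a..b}" using h by blast
    fix x assume x: "x \<in> {a..b}"
    define A B where "A = M * (m - x)" and "B = f m - f x - M * (m - x)"
    have "B\<^sup>2 \<le> (b - a) * R"
      unfolding B_def R_def using x ab by (intro H1_remainder[OF H]) (auto simp: m_def)
    then have "(1 + 1 / \<eta>) * B\<^sup>2 \<le> (1 + 1 / \<eta>) * ((b - a) * R)"
      using \<eta> by (intro mult_left_mono) auto
    moreover have "M * (b - a) / 2 - M * (x - a) = A" by (simp add: A_def m_def field_simps)
    moreover have "f m - f x = A + B" by (simp add: A_def B_def)
    ultimately show "(f m - f x)\<^sup>2 \<le> h x"
      unfolding h_def using sq_add_upper[OF \<eta>, of A B] by simp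
  qed
  also have "\<dots> = (1 + \<eta>) * (M\<^sup>2 * (b - a)^3 / 12) + (1 + 1 / \<eta>) * ((b - a)\<^sup>2 * R)"
    using integral_unique[OF h] by (simp add: power2_eq_square mult_ac)
  finally show ?thesis unfolding m_def .
qed

text \<open>With \<open>s = \<bar>J\<bar> / w\<close> and \<open>N * w \<ge> 1\<close> the argument
  of the logarithm is at most \<open>(N * w)\<^sup>2 * (1 + s)\<^sup>2\<close>. Thus every jump is
  charged the same leading cost, plus a term linear in its size that sums to a total
  variation.\<close>

lemma ln_jump_le:
  fixes N w J :: real
  assumes "N > 0" "w > 0" "N * w \<ge> 1"
  shows "ln (1 + (N * J)\<^sup>2) \<le> ln ((N * w)\<^sup>2) + 2 * \<bar>J\<bar> / w"
proof -
  define s where "s = \<bar>J\<bar> / w"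
  have s: "s \<ge> 0" "\<bar>N * J\<bar> = (N * w) * s" using assms by (auto simp: s_def abs_mult)
  have "1 + (N * J)\<^sup>2 = 1 + (N * w)\<^sup>2 * s\<^sup>2"
    using s(2) by (metis power2_abs power_mult_distrib)
  also have "\<dots> \<le> (N * w)\<^sup>2 + (N * w)\<^sup>2 * s\<^sup>2" using assms(3) by simp
  also have "\<dots> \<le> (N * w)\<^sup>2 * (1 + s)\<^sup>2"
    using s(1) by (simp add: power2_sum algebra_simps)
  finally have "ln (1 + (N * J)\<^sup>2) \<le> ln ((N * w)\<^sup>2 * (1 + s)\<^sup>2)"
    by (intro ln_mono) (auto simp: add_pos_nonneg)
  also have "\<dots> = ln ((N * w)\<^sup>2) + 2 * ln (1 + s)"
    using assms s(1) by (subst ln_mult) (auto simp: ln_realpow)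
  also have "2 * ln (1 + s) \<le> 2 * s" using ln_add_one_self_le_self[OF s(1)] by simp
  finally show ?thesis by (simp add: s_def)
qed

lemma cube_root_add_le:
  fixes x y :: real
  assumes "x \<ge> 0" "y \<ge> 0"
  shows "(x + y) powr (1/3) \<le> x powr (1/3) + y powr (1/3)"
proof -
  have "((x + y) powr (1/3))^3 \<le> (x powr (1/3) + y powr (1/3))^3"
  proof -
    have "u^3 + v^3 \<le> (u + v)^3" if "u \<ge> 0" "v \<ge> 0" for u v :: real
      using that by (simp add: power3_eq_cube algebra_simps)
    from this[of "x powr (1/3)" "y powr (1/3)"] show ?thesis
      using assms by (simp add: real_cube_root)
  qed
  then show ?thesis using power_le_imp_le_base[of "(x + y) powr (1/3)" 2] by (simp add: numeral_3_eq_3)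
qed

text \<open>At the optimal length the fidelity uses one third of
  \<open>\<gamma> * w\<^sup>2 * lam * (b - a)\<close>. The other two thirds, added on the left, are
  a reserve that pays for the jump at the end of the step.\<close>

lemma piece_upper:
  fixes M \<eta> \<kappa> w \<beta> :: real
  assumes H: "H1_with_deriv f g" and n: "n > 0" "i < j" "j \<le> n" and \<eta>: "0 < \<eta>" "\<eta> < 1"
    and pos: "\<beta> > 0" "\<kappa> > 0" "w > 0"
  defines "a \<equiv> real i / real n" and "b \<equiv> real j / real n"
  defines "lam \<equiv> (\<beta> * (M\<^sup>2 + \<eta>)) powr (1/3)" and "lam0 \<equiv> (\<beta> * \<eta>) powr (1/3)"
  assumes d: "b - a \<le> 2 * w / lam"
  defines "R \<equiv> integral {a..b} (\<lambda>x. (g x - M)\<^sup>2)" and "B \<equiv> \<beta> powr (1/3)" and "\<gamma> \<equiv> (1 + \<eta>) / (1 - \<eta>)"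
  shows "\<beta> * (\<Sum>k\<in>{i..<j}. integral (cell n k) (\<lambda>x. (f ((a + b) / 2) - f x)\<^sup>2)) + 2 / 3 * \<gamma> * w\<^sup>2 * lam * (b - a)
     \<le> w\<^sup>2 * (\<gamma> * (B * integral {a..b} (\<lambda>x. \<bar>g x\<bar> powr (2/3)) + (B * \<kappa> + lam0) * (b - a))
         + (\<gamma> * B / \<kappa>\<^sup>2 + (1 + 1 / \<eta>) * 4 * \<beta> / lam0\<^sup>2) * R)"
proof -
  let ?F = "\<Sum>k\<in>{i..<j}. integral (cell n k) (\<lambda>x. (f ((a + b) / 2) - f x)\<^sup>2)"
  let ?m = "\<bar>M\<bar> powr (2/3)"
  define D where "D = b - a"
  have ab: "0 \<le> a" "a \<le> b" "b \<le> 1" using n by (auto simp: a_def b_def divide_right_mono)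
  have D0: "D \<ge> 0" using ab by (simp add: D_def)
  have R: "R \<ge> 0"
    unfolding R_def using H1_integrable(2)[OF H, of "\<lambda>_. M"] ab
    by (intro integral_nonneg) (auto elim!: integrable_on_subinterval)
  have B: "B > 0" using pos by (auto simp: B_def)
  have M\<eta>: "M\<^sup>2 + \<eta> > 0" using \<eta> by (simp add: add_nonneg_pos)
  have l0: "lam0 > 0" using pos \<eta> by (simp add: lam0_def)
  have ll: "lam0 \<le> lam" unfolding lam_def lam0_def using pos \<eta> by (intro powr_mono2 mult_left_mono) auto
  have l: "lam > 0" using l0 ll by linarith
  have l3: "lam^3 = \<beta> * (M\<^sup>2 + \<eta>)" unfolding lam_def using pos M\<eta> by (intro real_cube_root) auto
  have \<gamma>: "1 + \<eta> \<le> \<gamma>" "\<gamma> > 0"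
    using \<eta> by (auto simp: \<gamma>_def field_simps)
  have D2: "D\<^sup>2 \<le> 4 * w\<^sup>2 / lam\<^sup>2"
    using power_mono[OF d, of 2] ab by (simp add: D_def power_divide)
  have D2': "D\<^sup>2 \<le> 4 * w\<^sup>2 / lam0\<^sup>2"
  proof -
    have "4 * w\<^sup>2 / lam\<^sup>2 \<le> 4 * w\<^sup>2 / lam0\<^sup>2"
      using ll l0 by (intro divide_left_mono power_mono mult_pos_pos) auto
    then show ?thesis using D2 by linarith
  qed
  have "?F \<le> (1 + \<eta>) * (M\<^sup>2 * D^3 / 12) + (1 + 1 / \<eta>) * (D\<^sup>2 * R)"
    unfolding D_def R_def a_def b_def by (rule piece_fidelity_upper[OF H n \<eta>(1)])
  then have "\<beta> * ?F \<le> \<beta> * ((1 + \<eta>) * (M\<^sup>2 * D^3 / 12) + (1 + 1 / \<eta>) * (D\<^sup>2 * R))"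
    using pos by (intro mult_left_mono) auto
  also have "\<dots> = (1 + \<eta>) * ((\<beta> * M\<^sup>2) * (D * D\<^sup>2) / 12) + (1 + 1 / \<eta>) * \<beta> * (D\<^sup>2 * R)"
    by (simp add: power2_eq_square power3_eq_cube algebra_simps)
  \<comment> \<open>Only two of the three factors \<open>D\<close> are replaced by the bound on the
    step length, so the estimate stays linear in \<open>D\<close> and can be summed over the
    steps.\<close>
  also have "\<dots> \<le> \<gamma> * (lam^3 * (D * (4 * w\<^sup>2 / lam\<^sup>2)) / 12) + (1 + 1 / \<eta>) * \<beta> * (4 * w\<^sup>2 / lam0\<^sup>2 * R)"
    using pos \<eta> \<gamma> D0 R l D2 D2' l3
    by (intro add_mono mult_mono mult_left_mono mult_right_mono divide_right_mono) auto
  also have "lam^3 * (D * (4 * w\<^sup>2 / lam\<^sup>2)) / 12 = w\<^sup>2 * lam * D / 3"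
    using l by (simp add: power2_eq_square power3_eq_cube field_simps)
  finally have 1: "\<beta> * ?F + 2 / 3 * \<gamma> * w\<^sup>2 * lam * D
    \<le> \<gamma> * (w\<^sup>2 * (lam * D)) + (1 + 1 / \<eta>) * \<beta> * (4 * w\<^sup>2 / lam0\<^sup>2 * R)"
    by (simp add: algebra_simps)
  have "lam \<le> B * ?m + lam0"
  proof -
    have "lam \<le> (\<beta> * M\<^sup>2) powr (1/3) + lam0"
      unfolding lam_def lam0_def distrib_left using pos \<eta> by (intro cube_root_add_le) auto
    also have "(\<beta> * M\<^sup>2) powr (1/3) = B * ?m"
    proof -
      have "(M\<^sup>2) powr (1/3) = ?m"
      proof (cases "M = 0")
        case False
        then have "M\<^sup>2 = \<bar>M\<bar> powr 2" by (simp add: powr_numeral)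
        then show ?thesis by (simp only: powr_powr) simp
      qed simp
      then show ?thesis using pos by (simp add: powr_mult B_def)
    qed
    finally show ?thesis .
  qed
  then have "lam * D \<le> (B * ?m + lam0) * D" using D0 by (rule mult_right_mono)
  also have "\<dots> = B * (D * ?m) + lam0 * D" by (simp add: algebra_simps)
  also have "B * (D * ?m) \<le> B * (integral {a..b} (\<lambda>x. \<bar>g x\<bar> powr (2/3)) + \<kappa> * D + R / \<kappa>\<^sup>2)"
    unfolding D_def R_def using integral_powr_two_thirds_le(2)[OF H ab pos(2)] B
    by (intro mult_left_mono) auto
  finally have "\<gamma> * (w\<^sup>2 * (lam * D)) \<le> \<gamma> * (w\<^sup>2 *
     (B * (integral {a..b} (\<lambda>x. \<bar>g x\<bar> powr (2/3)) + \<kappa> * D + R / \<kappa>\<^sup>2) + lam0 * D))"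
    using \<gamma> by (intro mult_left_mono) auto
  with 1 have 2: "\<beta> * ?F + 2 / 3 * \<gamma> * w\<^sup>2 * lam * D \<le> \<gamma> * (w\<^sup>2 *
     (B * (integral {a..b} (\<lambda>x. \<bar>g x\<bar> powr (2/3)) + \<kappa> * D + R / \<kappa>\<^sup>2) + lam0 * D))
      + (1 + 1 / \<eta>) * \<beta> * (4 * w\<^sup>2 / lam0\<^sup>2 * R)" by linarith
  have "\<gamma> * (w\<^sup>2 * (B * (I + \<kappa> * D + R / \<kappa>\<^sup>2) + lam0 * D)) + (1 + 1 / \<eta>) * \<beta> * (4 * w\<^sup>2 / lam0\<^sup>2 * R)
    = w\<^sup>2 * (\<gamma> * (B * I + (B * \<kappa> + lam0) * D) + (\<gamma> * B / \<kappa>\<^sup>2 + (1 + 1 / \<eta>) * 4 * \<beta> / lam0\<^sup>2) * R)" for I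
    by (simp add: distrib_left distrib_right add_divide_distrib mult_ac)
  with 2 show ?thesis by (simp only: D_def)
qed

text \<open>Suited to a construction from right to left: the jump into cell \<open>i\<close> is left
  out and is paid for when a further piece is put in front.\<close>

definition tail_energy :: "nat \<Rightarrow> real \<Rightarrow> (real \<Rightarrow> real) \<Rightarrow> nat \<Rightarrow> (nat \<Rightarrow> real) \<Rightarrow> real" where
  "tail_energy n \<beta> f i U =
     (\<Sum>k\<in>{i..<n - 1}. ln (1 + (real n * (U (Suc k) - U k))\<^sup>2)) / real n
     + \<beta> * (\<Sum>k\<in>{i..<n}. integral (cell n k) (\<lambda>x. (U k - f x)\<^sup>2))"

lemma tail_energy_const:
  "tail_energy n \<beta> f i (\<lambda>_. c) = \<beta> * (\<Sum>k\<in>{i..<n}. integral (cell n k) (\<lambda>x. (c - f x)\<^sup>2))"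
  by (simp add: tail_energy_def)

lemma tail_energy_prepend:
  assumes "i < j" "j < n"
  shows "tail_energy n \<beta> f i (\<lambda>k. if k < j then c else U k) =
    \<beta> * (\<Sum>k\<in>{i..<j}. integral (cell n k) (\<lambda>x. (c - f x)\<^sup>2))
    + ln (1 + (real n * (U j - c))\<^sup>2) / real n + tail_energy n \<beta> f j U"
proof -
  let ?V = "\<lambda>k. if k < j then c else U k"
  let ?l = "\<lambda>U k. ln (1 + (real n * (U (Suc k) - U k))\<^sup>2)"
  have "(\<Sum>k\<in>{i..<n - 1}. ?l ?V k) = (\<Sum>k\<in>{i..<j - 1}. ?l ?V k) + (\<Sum>k\<in>{j - 1..<n - 1}. ?l ?V k)"
    using assms by (intro sum.atLeastLessThan_concat[symmetric]) auto
  also have "(\<Sum>k\<in>{i..<j - 1}. ?l ?V k) = 0"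
    by (intro sum.neutral) auto
  \<comment> \<open>The jump at index \<open>j - 1\<close>, from \<open>c\<close> to
    \<open>U j\<close>, is the only new one.\<close>
  also have "(\<Sum>k\<in>{j - 1..<n - 1}. ?l ?V k) = ?l ?V (j - 1) + (\<Sum>k\<in>{j..<n - 1}. ?l ?V k)"
    using assms by (subst sum.atLeast_Suc_lessThan) auto
  also have "?l ?V (j - 1) = ln (1 + (real n * (U j - c))\<^sup>2)" using assms by simp
  also have "(\<Sum>k\<in>{j..<n - 1}. ?l ?V k) = (\<Sum>k\<in>{j..<n - 1}. ?l U k)" by (intro sum.cong) auto
  finally have 1: "(\<Sum>k\<in>{i..<n - 1}. ?l ?V k) = ln (1 + (real n * (U j - c))\<^sup>2) + (\<Sum>k\<in>{j..<n - 1}. ?l U k)"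
    by simp
  let ?h = "\<lambda>U k. integral (cell n k) (\<lambda>x. (U k - f x)\<^sup>2)"
  have "(\<Sum>k\<in>{i..<n}. ?h ?V k) = (\<Sum>k\<in>{i..<j}. ?h ?V k) + (\<Sum>k\<in>{j..<n}. ?h ?V k)"
    using assms by (intro sum.atLeastLessThan_concat[symmetric]) auto
  also have "(\<Sum>k\<in>{i..<j}. ?h ?V k) = (\<Sum>k\<in>{i..<j}. ?h (\<lambda>_. c) k)" by (intro sum.cong) auto
  also have "(\<Sum>k\<in>{j..<n}. ?h ?V k) = (\<Sum>k\<in>{j..<n}. ?h U k)" by (intro sum.cong) auto
  finally have 2: "(\<Sum>k\<in>{i..<n}. ?h ?V k) = (\<Sum>k\<in>{i..<j}. ?h (\<lambda>_. c) k) + (\<Sum>k\<in>{j..<n}. ?h U k)" .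
  show ?thesis unfolding tail_energy_def 1 2 by (simp add: add_divide_distrib algebra_simps)
qed

text \<open>The bound is kept as a difference of values of one function, so that it telescopes along
  the midpoints of the steps.\<close>

lemma H1_diff_abs_le:
  assumes "H1_with_deriv f g" "0 \<le> x" "x \<le> y" "y \<le> 1"
  shows "\<bar>f y - f x\<bar> \<le> integral {0..y} (\<lambda>t. \<bar>g t\<bar>) - integral {0..x} (\<lambda>t. \<bar>g t\<bar>)"
proof -
  have g: "g integrable_on {0..1}" "(\<lambda>t. \<bar>g t\<bar>) integrable_on {0..1}"
    using H1_integrable(4)[OF assms(1), of "\<lambda>_. 0"] H1_integrable(1)[OF assms(1), of "\<lambda>_. 0"] by auto
  then have gs: "g integrable_on {x..y}" "(\<lambda>t. \<bar>g t\<bar>) integrable_on {x..y}" "(\<lambda>t. \<bar>g t\<bar>) integrable_on {0..y}"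
    using assms by (auto elim!: integrable_on_subinterval)
  have "f y - f x = integral {x..y} g" using assms by (intro H1_diff)
  then have "\<bar>f y - f x\<bar> \<le> integral {x..y} (\<lambda>t. \<bar>g t\<bar>)"
    using integral_norm_bound_integral[OF gs(1,2)] by simp
  also have "\<dots> = integral {0..y} (\<lambda>t. \<bar>g t\<bar>) - integral {0..x} (\<lambda>t. \<bar>g t\<bar>)"
    using Henstock_Kurzweil_Integration.integral_combine[OF _ _ gs(3), of x] assms by simp
  finally show ?thesis .
qed

text \<open>The competitor takes steps of the optimal length \<open>2 w / lam\<close>, where \<open>\<eta>\<close> keeps \<open>lam\<close> away from zero
  at points of vanishing slope. It is built from right to left; the sizes of the jumps enter the
  energy only through the variation of \<open>f\<close> between the midpoints of consecutive steps, which telescopes.\<close>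
lemma discrete_energy_upper:
  fixes \<phi> :: "real \<Rightarrow> real" and \<beta> \<eta> \<kappa> \<rho> \<Lambda> w :: real and n :: nat
  assumes H: "H1_with_deriv f g" and n: "n > 0" and \<eta>: "0 < \<eta>" "\<eta> < 1"
    and pos: "\<beta> > 0" "\<kappa> > 0" "w > 0"
    and w3: "w^3 = ln (real n) / real n"
    and nw: "real n * w \<ge> 1" and lnw: "ln ((real n * w)\<^sup>2) \<le> (1 + \<eta>) * (4 / 3) * ln (real n)"
    and \<phi>: "continuous_on {0..1} \<phi>"
    and \<Lambda>: "\<And>x. x \<in> {0..1} \<Longrightarrow> (\<beta> * ((\<phi> x)\<^sup>2 + \<eta>)) powr (1/3) \<le> \<Lambda>"
    and step: "\<Lambda> \<le> \<eta> * (2 * real n * w)"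
  defines "lam0 \<equiv> (\<beta> * \<eta>) powr (1/3)" and "B \<equiv> \<beta> powr (1/3)" and "\<gamma> \<equiv> (1 + \<eta>) / (1 - \<eta>)"
  assumes \<rho>: "\<And>x y. x \<in> {0..1} \<Longrightarrow> y \<in> {0..1} \<Longrightarrow> \<bar>x - y\<bar> \<le> 2 * w / lam0 \<Longrightarrow> \<bar>\<phi> x - \<phi> y\<bar> \<le> \<rho>"
  shows "\<exists>U. discrete_energy n \<beta> f U \<le>
    w\<^sup>2 * (\<gamma> * (B * integral {0..1} (\<lambda>x. \<bar>g x\<bar> powr (2/3)) + (B * \<kappa> + lam0))
      + (\<gamma> * B / \<kappa>\<^sup>2 + (1 + 1 / \<eta>) * 4 * \<beta> / lam0\<^sup>2) * integral {0..1} (\<lambda>x. (\<bar>g x - \<phi> x\<bar> + \<rho>)\<^sup>2))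
    + 2 / (real n * w) * integral {0..1} (\<lambda>x. \<bar>g x\<bar>)"
proof -
  let ?G = "\<lambda>x. \<bar>g x\<bar> powr (2/3)" and ?E = "\<lambda>x. (\<bar>g x - \<phi> x\<bar> + \<rho>)\<^sup>2"
  define C where "C = \<gamma> * B / \<kappa>\<^sup>2 + (1 + 1 / \<eta>) * 4 * \<beta> / lam0\<^sup>2"
  \<comment> \<open>The bound for the energy accumulated on \<open>[0, x]\<close>; the contribution
    of a step is a difference of its values and telescopes.\<close>
  define A where "A x = \<gamma> * (B * integral {0..x} ?G + (B * \<kappa> + lam0) * x) + C * integral {0..x} ?E" for x
  define W where "W x = integral {0..x} (\<lambda>t. \<bar>g t\<bar>)" for x
  define K where "K = 2 / (real n * w)"
  have K0: "K \<ge> 0" using pos by (simp add: K_def)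
  have \<gamma>0: "\<gamma> > 0" using \<eta> by (simp add: \<gamma>_def)
  have l0: "lam0 > 0" using pos \<eta> by (simp add: lam0_def)
  have C0: "C \<ge> 0" using pos \<eta> \<gamma>0 by (simp add: C_def B_def)
  have W: "\<bar>f y - f x\<bar> \<le> W y - W x" if "0 \<le> x" "x \<le> y" "y \<le> 1" for x y
    unfolding W_def by (rule H1_diff_abs_le[OF H that])
  \<comment> \<open>In the construction \<open>m\<close> is the midpoint of the first step.
    Recording it lets the jump from a step placed further left be bounded by a difference of values
    of \<open>W\<close>.\<close>
  have main: "\<exists>U m. m \<in> {real i / real n..1} \<and> U i = f m \<and>
      tail_energy n \<beta> f i U \<le> w\<^sup>2 * (A 1 - A (real i / real n)) + K * (W 1 - W m)" if "i < n" for i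
    using that
  proof (induction "n - i" arbitrary: i rule: less_induct)
    case less
    define a where "a = real i / real n"
    define M where "M = \<phi> a"
    define lam where "lam = (\<beta> * (M\<^sup>2 + \<eta>)) powr (1/3)"
    define p where "p = nat \<lfloor>2 * real n * w / lam\<rfloor>"
    define j where "j = min n (i + p)"
    define b where "b = real j / real n"
    define m0 where "m0 = (a + b) / 2"
    define R where "R = integral {a..b} (\<lambda>x. (g x - M)\<^sup>2)"
    define F where "F = (\<Sum>k\<in>{i..<j}. integral (cell n k) (\<lambda>x. (f m0 - f x)\<^sup>2))"
    have a01: "a \<in> {0..1}" using less.prems by (auto simp: a_def)
    have M\<eta>: "M\<^sup>2 + \<eta> > 0" using \<eta> by (simp add: add_nonneg_pos)
    have l: "lam > 0" using pos M\<eta> by (simp add: lam_def)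
    have ll: "lam0 \<le> lam" unfolding lam_def lam0_def using pos \<eta> by (intro powr_mono2 mult_left_mono) auto
    have "lam \<le> \<eta> * (2 * real n * w)" using \<Lambda>[OF a01] step by (simp add: lam_def M_def)
    then have q1: "1 \<le> \<eta> * (2 * real n * w / lam)" using l by (simp add: field_simps)
    define q where "q = 2 * real n * w / lam"
    have "q > 0" using l pos n by (simp add: q_def)
    have q1: "1 \<le> \<eta> * q" using q1 by (simp add: q_def)
    then have "1 \<le> q" using \<eta> \<open>q > 0\<close> mult_right_mono[of \<eta> 1 q] by linarith
    then have p: "real p \<le> q" "q - 1 \<le> real p" "p \<ge> 1" unfolding p_def q_def[symmetric] by linarith+
    have ij: "i < j" "j \<le> n" using p less.prems by (auto simp: j_def)
    have ab: "0 \<le> a" "a < b" "b \<le> 1" using ij n by (auto simp: a_def b_def divide_strict_right_mono)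
    have m0: "a \<le> m0" "m0 \<le> b" using ab by (auto simp: m0_def)
    have "real j - real i \<le> real p" unfolding j_def by linarith
    then have "b - a \<le> real p / real n"
      by (simp add: a_def b_def divide_right_mono flip: diff_divide_distrib)
    also have "\<dots> \<le> q / real n" using p by (intro divide_right_mono) auto
    also have "\<dots> = 2 * w / lam" using n by (simp add: q_def)
    finally have d: "b - a \<le> 2 * w / lam" .
    also have "\<dots> \<le> 2 * w / lam0" using ll l0 pos by (intro divide_left_mono) auto
    finally have d0: "b - a \<le> 2 * w / lam0" .
    have piece: "\<beta> * F + 2 / 3 * \<gamma> * w\<^sup>2 * lam * (b - a)
      \<le> w\<^sup>2 * (\<gamma> * (B * integral {a..b} ?G + (B * \<kappa> + lam0) * (b - a)) + C * R)"
      using piece_upper[OF H n ij \<eta> pos, of M] d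
      unfolding F_def m0_def a_def b_def C_def R_def lam_def lam0_def B_def \<gamma>_def by simp
    have sub: "h integrable_on {a..b}" "h integrable_on {0..b}" if "h integrable_on {0..1}" for h :: "real \<Rightarrow> real"
      using that ab by (auto elim!: integrable_on_subinterval)
    have I: "integral {0..b} h = integral {0..a} h + integral {a..b} h" if "h integrable_on {0..1}"
      for h :: "real \<Rightarrow> real"
      using Henstock_Kurzweil_Integration.integral_combine[OF _ _ sub(2)[OF that], of a] ab by simp
    note gi = H1_integrable[OF H \<phi>]
    have RE: "R \<le> integral {a..b} ?E"
      unfolding R_def
    proof (rule integral_le)
      show "(\<lambda>x. (g x - M)\<^sup>2) integrable_on {a..b}"
        by (intro sub H1_integrable[OF H] continuous_intros)
      show "?E integrable_on {a..b}" by (intro sub gi)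
      fix x assume x: "x \<in> {a..b}"
      have "\<bar>\<phi> x - \<phi> a\<bar> \<le> \<rho>" using x ab d0 by (intro \<rho>) auto
      then show "(g x - M)\<^sup>2 \<le> ?E x"
        unfolding M_def by (intro abs_le_square_iff[THEN iffD1]) auto
    qed
    have "A b - A a = \<gamma> * (B * integral {a..b} ?G + (B * \<kappa> + lam0) * (b - a)) + C * integral {a..b} ?E"
      unfolding A_def I[OF gi(3)] I[OF gi(5)] by (simp add: algebra_simps)
    moreover have "C * R \<le> C * integral {a..b} ?E" using RE C0 by (rule mult_left_mono)
    ultimately have "\<gamma> * (B * integral {a..b} ?G + (B * \<kappa> + lam0) * (b - a)) + C * R \<le> A b - A a" by simp
    then have "w\<^sup>2 * (\<gamma> * (B * integral {a..b} ?G + (B * \<kappa> + lam0) * (b - a)) + C * R) \<le> w\<^sup>2 * (A b - A a)"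
      by (rule mult_left_mono) simp
    with piece have piece': "\<beta> * F + 2 / 3 * \<gamma> * w\<^sup>2 * lam * (b - a) \<le> w\<^sup>2 * (A b - A a)" by linarith
    show ?case
    proof (cases "j = n")
      \<comment> \<open>The last step may be shorter than intended, but no jump follows it, so its
        reserve is simply discarded.\<close>
      case True
      then have b1: "b = 1" using n by (simp add: b_def)
      have "0 \<le> 2 / 3 * \<gamma> * w\<^sup>2 * lam * (1 - a)" using \<gamma>0 l ab b1 by simp
      then have "\<beta> * F \<le> w\<^sup>2 * (A 1 - A a)" using piece' unfolding b1 by linarith
      moreover have "0 \<le> K * (W 1 - W m0)"
        using W[of m0 1] m0 ab K0 by (intro mult_nonneg_nonneg) auto
      ultimately show ?thesis
        using m0 ab less.prems True
        by (intro exI[of _ "\<lambda>_. f m0"] exI[of _ m0]) (auto simp: tail_energy_const F_def a_def)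
    next
      case False
      then have jn: "j < n" "j = i + p" using ij by (auto simp: j_def)
      then obtain U m where m: "m \<in> {b..1}" "U j = f m"
        and U: "tail_energy n \<beta> f j U \<le> w\<^sup>2 * (A 1 - A b) + K * (W 1 - W m)"
        using less.hyps[of j] ij unfolding b_def by force
      have "ln (1 + (real n * (U j - f m0))\<^sup>2) \<le> ln ((real n * w)\<^sup>2) + 2 * \<bar>U j - f m0\<bar> / w"
        by (rule ln_jump_le) (use n pos nw in auto)
      also have "2 * \<bar>U j - f m0\<bar> / w \<le> 2 * (W m - W m0) / w"
        unfolding m(2) using W[of m0 m] m m0 ab pos by (intro divide_right_mono mult_left_mono) auto
      finally have "ln (1 + (real n * (U j - f m0))\<^sup>2)
        \<le> (1 + \<eta>) * (4 / 3) * ln (real n) + 2 * (W m - W m0) / w" using lnw by linarith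
      then have "ln (1 + (real n * (U j - f m0))\<^sup>2) / real n
        \<le> ((1 + \<eta>) * (4 / 3) * ln (real n) + 2 * (W m - W m0) / w) / real n"
        by (rule divide_right_mono) simp
      also have "\<dots> = (1 + \<eta>) * (4 / 3) * w^3 + K * (W m - W m0)"
        by (simp add: w3 K_def add_divide_distrib mult.commute)
      finally have jump: "ln (1 + (real n * (U j - f m0))\<^sup>2) / real n
        \<le> (1 + \<eta>) * (4 / 3) * w^3 + K * (W m - W m0)" .
      \<comment> \<open>Rounding the length down to whole cells loses at most one of
        \<open>q\<close> cells, a fraction at most \<open>\<eta>\<close> because
        \<open>1 \<le> \<eta> * q\<close>.\<close>
      have "(1 - \<eta>) * (2 * w) \<le> lam * (b - a)"
      proof -
        have "(1 - \<eta>) * q \<le> real p" using p q1 by (simp add: algebra_simps)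
        moreover have "b - a = real p / real n"
          unfolding a_def b_def jn(2) by (simp add: add_divide_distrib)
        moreover have "(1 - \<eta>) * (2 * w) = lam * ((1 - \<eta>) * q / real n)"
          using l n by (simp add: q_def)
        ultimately show ?thesis using l by (simp add: divide_right_mono mult_left_mono)
      qed
      then have "2 / 3 * \<gamma> * w\<^sup>2 * ((1 - \<eta>) * (2 * w)) \<le> 2 / 3 * \<gamma> * w\<^sup>2 * (lam * (b - a))"
        using \<gamma>0 by (intro mult_left_mono) auto
      \<comment> \<open>The form of \<open>\<gamma>\<close> comes from here: it compensates both the
        shortening factor \<open>1 - \<eta>\<close> and the excess \<open>1 + \<eta>\<close> in the
        jump cost.\<close>
      moreover have "2 / 3 * \<gamma> * w\<^sup>2 * ((1 - \<eta>) * (2 * w)) = (1 + \<eta>) * (4 / 3) * w^3"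
      proof -
        have "\<gamma> * (1 - \<eta>) = 1 + \<eta>" using \<eta> by (simp add: \<gamma>_def)
        moreover have "2 / 3 * \<gamma> * w\<^sup>2 * ((1 - \<eta>) * (2 * w)) = (\<gamma> * (1 - \<eta>)) * (4 / 3) * w^3"
          by (simp add: power2_eq_square power3_eq_cube)
        ultimately show ?thesis by simp
      qed
      ultimately have "(1 + \<eta>) * (4 / 3) * w^3 \<le> 2 / 3 * \<gamma> * w\<^sup>2 * lam * (b - a)" by (simp only: mult.assoc)
      then have "tail_energy n \<beta> f i (\<lambda>k. if k < j then f m0 else U k)
        \<le> \<beta> * F + (2 / 3 * \<gamma> * w\<^sup>2 * lam * (b - a) + K * (W m - W m0))
          + (w\<^sup>2 * (A 1 - A b) + K * (W 1 - W m))"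
        unfolding tail_energy_prepend[OF ij(1) jn(1)] F_def using jump U by linarith
      also have "\<dots> = (\<beta> * F + 2 / 3 * \<gamma> * w\<^sup>2 * lam * (b - a)) + w\<^sup>2 * (A 1 - A b) + K * (W 1 - W m0)"
        by (simp add: algebra_simps)
      also have "\<dots> \<le> w\<^sup>2 * (A b - A a) + w\<^sup>2 * (A 1 - A b) + K * (W 1 - W m0)"
        using piece' by simp
      also have "\<dots> = w\<^sup>2 * (A 1 - A a) + K * (W 1 - W m0)" by (simp add: algebra_simps)
      finally show ?thesis
        using m0 ab ij
        by (intro exI[of _ "\<lambda>k. if k < j then f m0 else U k"] exI[of _ m0]) (auto simp: a_def)
    qed
  qed
  obtain U m where m: "m \<in> {0..1}"
    and U: "tail_energy n \<beta> f 0 U \<le> w\<^sup>2 * (A 1 - A 0) + K * (W 1 - W m)"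
    using main[OF n] by auto
  have "discrete_energy n \<beta> f U = tail_energy n \<beta> f 0 U"
    by (simp add: discrete_energy_def tail_energy_def lessThan_atLeast0)
  moreover have "A 0 = 0" by (simp add: A_def)
  moreover have "K * (W 1 - W m) \<le> K * W 1"
    using W[of 0 m] m K0 by (intro mult_left_mono) (auto simp: W_def)
  ultimately show ?thesis
    using U unfolding A_def K_def W_def C_def by (intro exI[of _ U]) simp
qed

section \<open>Passage to the limit\<close>

lemma omega_pos: "n \<ge> 2 \<Longrightarrow> omega n > 0"
  by (simp add: omega_def)

lemma omega_cube: "n > 0 \<Longrightarrow> omega n ^ 3 = ln (real n) / real n"
  unfolding omega_def by (intro real_cube_root) auto

lemma omega_tendsto_0: "omega \<longlonglongrightarrow> 0"
  unfolding omega_def by real_asymp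

lemma n_omega_at_top: "filterlim (\<lambda>n. real n * omega n) at_top sequentially"
  unfolding omega_def by real_asymp

text \<open>Up to logarithms the square of \<open>omega n\<close> is \<open>n\<close> to the power
  -2/3, so a threshold with a smaller exponent than 2/3 makes the total variation of the small
  increments vanish when the energy is of order \<open>(omega n)\<^sup>2\<close>.\<close>

lemma powr_omega_tendsto_0:
  assumes "0 < t" "t < 1"
  shows "(\<lambda>n. real n powr (2 * (1 - t) / 3) * (omega n)\<^sup>2) \<longlonglongrightarrow> 0"
proof -
  have "(\<lambda>n::nat. real n powr (- (2 * t / 3)) * ln (real n) powr (2/3)) \<longlonglongrightarrow> 0"
    using assms by real_asymp
  moreover have "\<forall>\<^sub>F n in sequentially. real n powr (- (2 * t / 3)) * ln (real n) powr (2/3)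
    = real n powr (2 * (1 - t) / 3) * (omega n)\<^sup>2"
    using eventually_gt_at_top[of 2]
  proof eventually_elim
    case (elim n)
    have "(omega n)\<^sup>2 = (ln (real n) / real n) powr (2/3)"
      using elim by (simp add: omega_def powr_power)
    also have "\<dots> = ln (real n) powr (2/3) / real n powr (2/3)"
      by (rule powr_divide)
    also have "\<dots> = ln (real n) powr (2/3) * real n powr (- (2/3))"
      by (simp only: powr_minus divide_inverse)
    finally have "real n powr (2 * (1 - t) / 3) * (omega n)\<^sup>2
      = real n powr (2 * (1 - t) / 3 + (- (2/3))) * ln (real n) powr (2/3)"
      by (simp only: powr_add mult_ac)
    also have "2 * (1 - t) / 3 + (- (2/3)) = - (2 * t / 3)" by (simp add: field_simps)
    finally show ?case by simp
  qed
  ultimately show ?thesis by (rule Lim_transform_eventually)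
qed

lemma ln_n_omega_le:
  assumes "\<eta> > 0"
  shows "\<forall>\<^sub>F n in sequentially. ln ((real n * omega n)\<^sup>2) \<le> (1 + \<eta>) * (4 / 3) * ln (real n)"
proof -
  have "(\<lambda>n. ln ((real n * omega n)\<^sup>2) / ln (real n)) \<longlonglongrightarrow> 4 / 3"
    unfolding omega_def by real_asymp
  then have "\<forall>\<^sub>F n in sequentially. ln ((real n * omega n)\<^sup>2) / ln (real n) < (1 + \<eta>) * (4 / 3)"
    by (rule order_tendstoD) (use assms in auto)
  then show ?thesis
    using eventually_gt_at_top[of 2] by eventually_elim (auto simp: field_simps)
qed

text \<open>An L^2 error with square at most \<open>t^4\<close> and a later oscillation
  \<open>t\<^sup>2\<close> give an integral of order \<open>t^4\<close>, enough to absorb the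
  coefficients of order t^(-3) and t^(-2) in the two bounds.\<close>

lemma approx_slope:
  assumes H: "H1_with_deriv f g" and "t > 0"
  obtains \<phi> where "continuous_on {0..1} \<phi>" "integral {0..1} (\<lambda>x. (\<bar>g x - \<phi> x\<bar> + t\<^sup>2)\<^sup>2) \<le> 4 * t^4"
proof -
  obtain \<phi> where \<phi>: "continuous_on {0..1} \<phi>" "integral {0..1} (\<lambda>x. (g x - \<phi> x)\<^sup>2) \<le> t^4"
    using L2_continuous_approx[of g "t^4"] H \<open>t > 0\<close> unfolding H1_with_deriv_def by auto
  have c: "((\<lambda>x. 2 * t^4) has_integral 2 * t^4) {0..1::real}"
    using has_integral_const_real[of "2 * t^4" 0 1] by simp
  have "((\<lambda>x. 2 * (g x - \<phi> x)\<^sup>2 + 2 * t^4) has_integral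
      2 * integral {0..1} (\<lambda>x. (g x - \<phi> x)\<^sup>2) + 2 * t^4) {0..1}"
    by (intro has_integral_add has_integral_mult_right integrable_integral H1_integrable[OF H \<phi>(1)] c)
  then have "integral {0..1} (\<lambda>x. (\<bar>g x - \<phi> x\<bar> + t\<^sup>2)\<^sup>2) \<le> 2 * integral {0..1} (\<lambda>x. (g x - \<phi> x)\<^sup>2) + 2 * t^4"
  proof (rule has_integral_le[OF integrable_integral[OF H1_integrable(3)[OF H \<phi>(1)]]])
    fix x
    have "(\<bar>g x - \<phi> x\<bar> + t\<^sup>2)\<^sup>2 \<le> 2 * \<bar>g x - \<phi> x\<bar>\<^sup>2 + 2 * (t\<^sup>2)\<^sup>2"
      using zero_le_power2[of "\<bar>g x - \<phi> x\<bar> - t\<^sup>2"] unfolding power2_sum power2_diff by linarith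
    then show "(\<bar>g x - \<phi> x\<bar> + t\<^sup>2)\<^sup>2 \<le> 2 * (g x - \<phi> x)\<^sup>2 + 2 * t^4" by simp
  qed
  then show ?thesis using \<phi> that by fastforce
qed

lemma uniform_osc:
  fixes \<phi> :: "real \<Rightarrow> real"
  assumes "continuous_on {0..1} \<phi>" "\<rho> > 0"
  shows "\<forall>\<^sub>F n in sequentially. \<forall>x\<in>{0..1}. \<forall>y\<in>{0..1}. \<bar>x - y\<bar> \<le> c * omega n \<longrightarrow> \<bar>\<phi> x - \<phi> y\<bar> \<le> \<rho>"
proof -
  have "uniformly_continuous_on {0..1} \<phi>"
    using assms by (intro compact_uniformly_continuous) auto
  then obtain \<delta> where \<delta>: "\<delta> > 0" "\<And>x y. x \<in> {0..1} \<Longrightarrow> y \<in> {0..1} \<Longrightarrow> dist y x < \<delta> \<Longrightarrow> dist (\<phi> y) (\<phi> x) < \<rho>"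
    unfolding uniformly_continuous_on_def using \<open>\<rho> > 0\<close> by metis
  have "(\<lambda>n. c * omega n) \<longlonglongrightarrow> c * 0" by (intro tendsto_intros omega_tendsto_0)
  then have "\<forall>\<^sub>F n in sequentially. c * omega n < \<delta>" using \<delta>(1) by (auto dest: order_tendstoD)
  then show ?thesis
  proof eventually_elim
    case (elim n)
    show ?case
    proof (intro ballI impI)
      fix x y :: real
      assume "x \<in> {0..1}" "y \<in> {0..1}" "\<bar>x - y\<bar> \<le> c * omega n"
      then show "\<bar>\<phi> x - \<phi> y\<bar> \<le> \<rho>"
        using \<delta>(2)[of y x] elim by (simp add: dist_real_def)
    qed
  qed
qed

lemma compact_bound:
  fixes h :: "real \<Rightarrow> real"
  assumes "continuous_on {0..1} h"
  obtains C where "\<And>x. x \<in> {0..1} \<Longrightarrow> h x \<le> C"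
proof -
  have "\<exists>z\<in>{0..1}. \<forall>x\<in>{0..1}. h x \<le> h z"
    by (rule continuous_attains_sup[OF _ _ assms]) auto
  then obtain z where "\<forall>x\<in>{0..1}. h x \<le> h z" by blast
  then show ?thesis using that by blast
qed

text \<open>Every parameter of \<open>discrete_energy_lower\<close> is tied to \<open>t\<close>:
  \<open>\<eta>\<close> and \<open>\<kappa>\<close> are \<open>t\<close>, \<open>\<theta>\<close> is
  \<open>1 - t\<close>, \<open>L\<close> is \<open>1 / t\<close> and \<open>\<rho>\<close> is
  \<open>t\<^sup>2\<close>. The artificial breaks then cost only O(t) relative to
  \<open>(omega n)\<^sup>2\<close>.\<close>

lemma m_min_lower:
  assumes H: "H1_with_deriv f g" and "\<beta> > 0" and t: "0 < t" "t < 1"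
  defines "B \<equiv> \<beta> powr (1/3)" and "I \<equiv> integral {0..1} (\<lambda>x. \<bar>g x\<bar> powr (2/3))"
  shows "\<forall>\<^sub>F n in sequentially. (1 - t)\<^sup>2 * (B * I) - (10 * \<beta> + 5 * B + 5) * t \<le> m_min n \<beta> f / (omega n)\<^sup>2"
proof -
  obtain \<phi> where \<phi>: "continuous_on {0..1} \<phi>" "integral {0..1} (\<lambda>x. (\<bar>g x - \<phi> x\<bar> + t\<^sup>2)\<^sup>2) \<le> 4 * t^4"
    using approx_slope[OF H t(1)] by blast
  obtain \<Phi> where \<Phi>: "\<And>x. x \<in> {0..1} \<Longrightarrow> \<bar>\<phi> x\<bar> powr (2/3) \<le> \<Phi>"
    by (rule compact_bound[of "\<lambda>x. \<bar>\<phi> x\<bar> powr (2/3)"]) (auto intro!: continuous_intros continuous_on_powr' \<phi>)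
  define C3 where "C3 = 1 / t * B * \<Phi> / t"
  define Y where "Y n = real n powr (2 * (1 - t) / 3)" for n
  let ?E = "\<lambda>x. (\<bar>g x - \<phi> x\<bar> + t\<^sup>2)\<^sup>2"
  have B: "B > 0" using \<open>\<beta> > 0\<close> by (simp add: B_def)
  have I0: "I \<ge> 0" unfolding I_def
    by (intro integral_nonneg H1_integrable(5)[OF H, of "\<lambda>_. 0"]) auto
  have "\<Phi> \<ge> 0" using order_trans[OF _ \<Phi>[of 0]] by auto
  then have C3: "C3 \<ge> 0" using B t by (simp add: C3_def)
  have Ylim: "(\<lambda>n. 1 / Y n) \<longlonglongrightarrow> 0" unfolding Y_def using t by real_asymp
  have "(\<lambda>n. C3 * (1 / Y n + 2 * (Y n * (omega n)\<^sup>2) * (B * I))) \<longlonglongrightarrow> C3 * (0 + 2 * 0 * (B * I))"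
    using powr_omega_tendsto_0[OF t] unfolding Y_def[symmetric] by (intro tendsto_intros Ylim)
  then have e4: "\<forall>\<^sub>F n in sequentially. C3 * (1 / Y n + 2 * (Y n * (omega n)\<^sup>2) * (B * I)) < t"
    using t by (auto dest: order_tendstoD)
  have e5: "\<forall>\<^sub>F n in sequentially. omega n < t"
    using order_tendstoD(2)[OF omega_tendsto_0 t(1)] .
  have e3: "\<forall>\<^sub>F n in sequentially. real n * omega n \<ge> 2"
    using n_omega_at_top by (simp add: filterlim_at_top)
  have e1: "\<forall>\<^sub>F n in sequentially. n \<ge> (2::nat)" by (rule eventually_ge_at_top)
  have "t\<^sup>2 > 0" using t by simp
  from uniform_osc[OF \<phi>(1) this, of "1 / t"] e1 e3 e4 e5 show ?thesis
  proof eventually_elim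
    case (elim n)
    define w where "w = omega n"
    \<comment> \<open>The length \<open>L * w\<close> measured in cells, rounded down. A number at
      least 2 keeps at least half of its value, which bounds \<open>n / q\<close>.\<close>
    define q where "q = nat \<lfloor>1 / t * w * real n\<rfloor>"
    define Q where "Q = (1 - t)\<^sup>2 * (B * I) - (10 * \<beta> + 5 * B + 5) * t"
    have n0: "n > 0" using elim by simp
    have w: "w > 0" unfolding w_def using elim by (intro omega_pos)
    have w3: "w^3 = ln (real n) / real n" unfolding w_def using n0 by (rule omega_cube)
    have "2 \<le> real n * w" using elim by (simp add: w_def)
    also have "real n * w * 1 \<le> real n * w * (1 / t)" using t w by (intro mult_left_mono) auto
    finally have x2: "2 \<le> 1 / t * w * real n" by (simp add: mult_ac)
    have "nat \<lfloor>x\<rfloor> > 0 \<and> real (nat \<lfloor>x\<rfloor>) \<le> x \<and> x / 2 \<le> real (nat \<lfloor>x\<rfloor>)" if "2 \<le> x" for x :: real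
      using that by linarith
    from this[OF x2] have q: "q > 0" "real q \<le> 1 / t * w * real n" "1 / t * w * real n / 2 \<le> real q"
      unfolding q_def by auto
    have nq: "real n / real q \<le> 2 * t / w"
    proof -
      have "w * real n \<le> 2 * t * real q" using q(3) t by (simp add: field_simps)
      then show ?thesis using q(1) w by (simp add: field_simps)
    qed
    have "w\<^sup>2 * Q \<le> discrete_energy n \<beta> f U" for U
    proof -
      define D where "D = discrete_energy n \<beta> f U"
      have Q_le: "Q \<le> B * I"
      proof -
        have "(1 - t)\<^sup>2 * (B * I) \<le> 1 * (B * I)"
          using t B I0 by (intro mult_right_mono power_le_one) auto
        moreover have "0 \<le> (10 * \<beta> + 5 * B + 5) * t" using t B \<open>\<beta> > 0\<close> by simp
        ultimately show ?thesis unfolding Q_def by linarith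
      qed
      \<comment> \<open>A competitor with energy above \<open>w\<^sup>2 * (B * I)\<close> satisfies
        the claim because \<open>Q \<le> B * I\<close>. Otherwise its energy is of order
        \<open>w\<^sup>2\<close>, and its small increments are negligible.\<close>
      show ?thesis
      proof (cases "D \<le> w\<^sup>2 * (B * I)")
        case False
        have "w\<^sup>2 * Q \<le> w\<^sup>2 * (B * I)" using Q_le by (intro mult_left_mono) auto
        then show ?thesis using False by (simp add: D_def)
      next
        case True
        have Y0: "Y n > 0" using n0 by (simp add: Y_def)
        have T: "C3 * (1 / Y n + 2 * Y n * D) \<le> t"
        proof -
          have "C3 * (1 / Y n + 2 * Y n * D) \<le> C3 * (1 / Y n + 2 * Y n * (w\<^sup>2 * (B * I)))"
            using True C3 Y0 by (intro mult_left_mono add_left_mono) auto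
          also have "\<dots> \<le> t" using elim by (simp add: w_def mult.assoc)
          finally show ?thesis .
        qed
        have E: "(2 * \<beta> * (1 / t)\<^sup>2 / t + B / t\<^sup>2) * integral {0..1} ?E \<le> 8 * \<beta> * t + 4 * B * t\<^sup>2"
        proof -
          have "(2 * \<beta> * (1 / t)\<^sup>2 / t + B / t\<^sup>2) * integral {0..1} ?E
            \<le> (2 * \<beta> * (1 / t)\<^sup>2 / t + B / t\<^sup>2) * (4 * t^4)"
            using \<phi>(2) t B \<open>\<beta> > 0\<close> by (intro mult_left_mono) auto
          also have "\<dots> = 8 * \<beta> * t + 4 * B * t\<^sup>2"
            using t by (simp add: field_simps power2_eq_square power4_eq_xxxx)
          finally show ?thesis .
        qed
        have qn: "real q / real n \<le> 1 / t * w" using q(2) n0 by (simp add: field_simps)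
        have "w\<^sup>2 * ((1 - t) * B * I - (2 * \<beta> * t\<^sup>2 / t + t * B)
          - (2 * \<beta> * (1 / t)\<^sup>2 / t + B / t\<^sup>2) * integral {0..1} ?E
          - 1 / t * B * \<Phi> / t * (1 / Y n + 2 * Y n * D))
          - 4 / 3 * w^3 * (1 + real n / real q) \<le> D / (1 - t)"
          unfolding B_def I_def Y_def D_def
          by (rule discrete_energy_lower[OF H elim(2) _ _ _ _ \<open>\<beta> > 0\<close> t(1) w _ q(1) qn w3 \<phi>(1) \<Phi>])
            (use t elim(1) in \<open>auto simp: w_def\<close>)
        moreover have "4 / 3 * w^3 * (1 + real n / real q) \<le> w\<^sup>2 * (4 * t)"
        proof -
          have "w * (1 + real n / real q) \<le> w * (1 + 2 * t / w)"
            using nq w by (intro mult_left_mono) auto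
          also have "\<dots> \<le> 3 * t" using w elim by (simp add: w_def field_simps)
          finally have "4 / 3 * w\<^sup>2 * (w * (1 + real n / real q)) \<le> 4 / 3 * w\<^sup>2 * (3 * t)"
            by (intro mult_left_mono) auto
          then show ?thesis by (simp add: power2_eq_square power3_eq_cube mult_ac)
        qed
        \<comment> \<open>Here \<open>10 * \<beta>\<close> is \<open>2 * \<beta>\<close> from the
          first error term plus \<open>8 * \<beta>\<close> from \<open>E\<close>,
          \<open>5 * B\<close> is \<open>B\<close> plus \<open>4 * B\<close>, and the 1 comes from
          \<open>T\<close>. The breaks add another \<open>4 * t\<close>.\<close>
        moreover have "w\<^sup>2 * ((1 - t) * (B * I) - (10 * \<beta> + 5 * B + 1) * t)
          \<le> w\<^sup>2 * ((1 - t) * B * I - (2 * \<beta> * t\<^sup>2 / t + t * B)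
          - (2 * \<beta> * (1 / t)\<^sup>2 / t + B / t\<^sup>2) * integral {0..1} ?E
          - 1 / t * B * \<Phi> / t * (1 / Y n + 2 * Y n * D))"
        proof (intro mult_left_mono)
          have "B * t\<^sup>2 \<le> B * t" using t B by (intro mult_left_mono) (auto simp: power2_eq_square)
          moreover have "2 * \<beta> * t\<^sup>2 / t = 2 * \<beta> * t" using t by (simp add: power2_eq_square)
          ultimately show "(1 - t) * (B * I) - (10 * \<beta> + 5 * B + 1) * t
            \<le> (1 - t) * B * I - (2 * \<beta> * t\<^sup>2 / t + t * B)
              - (2 * \<beta> * (1 / t)\<^sup>2 / t + B / t\<^sup>2) * integral {0..1} ?E
              - 1 / t * B * \<Phi> / t * (1 / Y n + 2 * Y n * D)"
            using E T[unfolded C3_def] by (simp add: algebra_simps)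
        qed simp
        ultimately have "w\<^sup>2 * ((1 - t) * (B * I) - (10 * \<beta> + 5 * B + 1) * t) - w\<^sup>2 * (4 * t) \<le> D / (1 - t)"
          by linarith
        \<comment> \<open>Clearing the division by \<open>1 - t\<close> produces the second factor
          in \<open>(1 - t)\<^sup>2\<close>.\<close>
        then have "(1 - t) * (w\<^sup>2 * ((1 - t) * (B * I) - (10 * \<beta> + 5 * B + 5) * t)) \<le> D"
          using t by (simp add: field_simps)
        moreover have "w\<^sup>2 * Q \<le> (1 - t) * (w\<^sup>2 * ((1 - t) * (B * I) - (10 * \<beta> + 5 * B + 5) * t))"
        proof -
          have "0 \<le> w\<^sup>2 * ((10 * \<beta> + 5 * B + 5) * t * t)" using t B \<open>\<beta> > 0\<close> by simp
          then show ?thesis by (simp add: Q_def power2_eq_square algebra_simps)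
        qed
        ultimately show ?thesis by (simp add: D_def)
      qed
    qed
    then have "w\<^sup>2 * Q \<le> m_min n \<beta> f" by (intro m_min_ge n0 H1_continuous[OF H])
    then show ?case using w unfolding Q_def[symmetric] w_def[symmetric] by (simp add: field_simps)
  qed
qed

text \<open>In \<open>discrete_energy_upper\<close> both \<open>\<eta>\<close> and
  \<open>\<kappa>\<close> are \<open>t\<close>, and \<open>\<rho>\<close> is
  \<open>t\<^sup>2\<close>. The slowest error as \<open>t\<close> tends to 0 is \<open>lam0\<close>,
  of order t^(1/3), caused by the regularization at vanishing slopes.\<close>

lemma m_min_upper:
  assumes H: "H1_with_deriv f g" and "\<beta> > 0" and t: "0 < t" "t < 1"
  defines "B \<equiv> \<beta> powr (1/3)" and "I \<equiv> integral {0..1} (\<lambda>x. \<bar>g x\<bar> powr (2/3))"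
    and "\<gamma> \<equiv> (1 + t) / (1 - t)"
  shows "\<forall>\<^sub>F n in sequentially. m_min n \<beta> f / (omega n)\<^sup>2
    \<le> \<gamma> * (B * I + (B * t + B * t powr (1/3))) + 4 * \<gamma> * B * t\<^sup>2 + 32 * B * t\<^sup>2 + t"
proof -
  obtain \<phi> where \<phi>: "continuous_on {0..1} \<phi>" "integral {0..1} (\<lambda>x. (\<bar>g x - \<phi> x\<bar> + t\<^sup>2)\<^sup>2) \<le> 4 * t^4"
    using approx_slope[OF H t(1)] by blast
  obtain \<Lambda> where \<Lambda>: "\<And>x. x \<in> {0..1} \<Longrightarrow> (\<beta> * ((\<phi> x)\<^sup>2 + t)) powr (1/3) \<le> \<Lambda>"
    by (rule compact_bound[of "\<lambda>x. (\<beta> * ((\<phi> x)\<^sup>2 + t)) powr (1/3)"])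
      (use t \<open>\<beta> > 0\<close> in \<open>auto intro!: continuous_intros continuous_on_powr' \<phi>\<close>)
  define lam0 where "lam0 = (\<beta> * t) powr (1/3)"
  define W where "W = integral {0..1} (\<lambda>x. \<bar>g x\<bar>)"
  let ?E = "\<lambda>x. (\<bar>g x - \<phi> x\<bar> + t\<^sup>2)\<^sup>2"
  have B: "B > 0" "B^3 = \<beta>" using \<open>\<beta> > 0\<close> real_cube_root[of \<beta>] by (auto simp: B_def)
  have \<gamma>: "\<gamma> > 0" using t by (simp add: \<gamma>_def)
  have l0: "lam0 = B * t powr (1/3)" unfolding lam0_def B_def using t \<open>\<beta> > 0\<close> by (simp add: powr_mult)
  have E: "(\<gamma> * B / t\<^sup>2 + (1 + 1 / t) * 4 * \<beta> / lam0\<^sup>2) * integral {0..1} ?E \<le> 4 * \<gamma> * B * t\<^sup>2 + 32 * B * t\<^sup>2"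
  proof -
    \<comment> \<open>As t <= t^(2/3) for t < 1, this bounds the square of \<open>lam0\<close> below
      by \<open>B\<^sup>2 * t\<close>; together with \<open>1 + 1 / t \<le> 2 / t\<close> the
      coefficient becomes at most \<open>8 * B / t\<^sup>2\<close>.\<close>
    have "t powr 1 \<le> t powr (2/3)" using t by (intro powr_mono') auto
    then have "B\<^sup>2 * t \<le> lam0\<^sup>2"
      using B t by (simp add: l0 power_mult_distrib powr_power)
    then have "(1 + 1 / t) * 4 * \<beta> / lam0\<^sup>2 \<le> (2 / t) * 4 * \<beta> / (B\<^sup>2 * t)"
      using t B \<open>\<beta> > 0\<close> by (intro frac_le mult_right_mono) (auto simp: field_simps)
    also have "\<dots> = 8 * B / t\<^sup>2"
      using B t unfolding B(2)[symmetric] by (simp add: field_simps power2_eq_square power3_eq_cube)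
    finally have "(\<gamma> * B / t\<^sup>2 + (1 + 1 / t) * 4 * \<beta> / lam0\<^sup>2) * integral {0..1} ?E
      \<le> (\<gamma> * B / t\<^sup>2 + 8 * B / t\<^sup>2) * (4 * t^4)"
      using \<phi>(2) t B \<gamma> \<open>\<beta> > 0\<close>
      by (intro mult_mono integral_nonneg H1_integrable[OF H \<phi>(1)]) auto
    also have "\<dots> = 4 * \<gamma> * B * t\<^sup>2 + 32 * B * t\<^sup>2"
      using t by (simp add: field_simps power2_eq_square power4_eq_xxxx)
    finally show ?thesis .
  qed
  have e1: "\<forall>\<^sub>F n in sequentially. n \<ge> (2::nat)" by (rule eventually_ge_at_top)
  have e2: "\<forall>\<^sub>F n in sequentially. real n * omega n \<ge> max 1 (\<Lambda> / (2 * t))"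
    using n_omega_at_top unfolding filterlim_at_top by blast
  have "(\<lambda>n::nat. 2 * W / ln (real n)) \<longlonglongrightarrow> 0" by real_asymp
  then have e3: "\<forall>\<^sub>F n::nat in sequentially. 2 * W / ln (real n) < t"
    using t(1) by (rule order_tendstoD)
  have "t\<^sup>2 > 0" using t by simp
  from uniform_osc[OF \<phi>(1) this, of "2 / lam0"] ln_n_omega_le[OF t(1)] e1 e2 e3 show ?thesis
  proof eventually_elim
    case (elim n)
    define w where "w = omega n"
    have n0: "n > 0" using elim by simp
    have w: "w > 0" unfolding w_def using elim by (intro omega_pos)
    have w3: "w^3 = ln (real n) / real n" unfolding w_def using n0 by (rule omega_cube)
    have nw: "1 \<le> real n * w" using elim by (simp add: w_def)
    have lnw: "ln ((real n * w)\<^sup>2) \<le> (1 + t) * (4 / 3) * ln (real n)" using elim by (simp add: w_def)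
    have step: "\<Lambda> \<le> t * (2 * real n * w)"
      using elim t by (simp add: w_def field_simps)
    obtain U where "discrete_energy n \<beta> f U \<le>
      w\<^sup>2 * (\<gamma> * (B * I + (B * t + lam0)) + (\<gamma> * B / t\<^sup>2 + (1 + 1 / t) * 4 * \<beta> / lam0\<^sup>2) * integral {0..1} ?E)
        + 2 / (real n * w) * W"
      using discrete_energy_upper[OF H n0 t \<open>\<beta> > 0\<close> t(1) w w3 nw lnw \<phi>(1) \<Lambda> step, where \<rho>="t\<^sup>2"] elim(1)
      unfolding lam0_def B_def \<gamma>_def I_def W_def w_def by auto
    then have "m_min n \<beta> f \<le> w\<^sup>2 * (\<gamma> * (B * I + (B * t + lam0)) +
        (\<gamma> * B / t\<^sup>2 + (1 + 1 / t) * 4 * \<beta> / lam0\<^sup>2) * integral {0..1} ?E) + 2 / (real n * w) * W"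
      using m_min_le[OF n0 \<open>\<beta> > 0\<close> H1_continuous[OF H], of U] by linarith
    \<comment> \<open>By the cube relation for \<open>w\<close>, the variation term is smaller than
      \<open>w\<^sup>2\<close> by a factor of order 1 / ln n, hence negligible.\<close>
    also have "2 / (real n * w) * W = w\<^sup>2 * (2 * W / ln (real n))"
    proof -
      have "ln (real n) = w^3 * real n" using w3 n0 by simp
      then show ?thesis using w n0 by (simp add: power2_eq_square power3_eq_cube)
    qed
    also have "w\<^sup>2 * (\<gamma> * (B * I + (B * t + lam0)) +
        (\<gamma> * B / t\<^sup>2 + (1 + 1 / t) * 4 * \<beta> / lam0\<^sup>2) * integral {0..1} ?E) + w\<^sup>2 * (2 * W / ln (real n))
      \<le> w\<^sup>2 * (\<gamma> * (B * I + (B * t + lam0)) + (4 * \<gamma> * B * t\<^sup>2 + 32 * B * t\<^sup>2)) + w\<^sup>2 * t"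
      using E elim by (intro add_mono mult_left_mono order_refl) auto
    finally have "m_min n \<beta> f \<le> w\<^sup>2 * (\<gamma> * (B * I + (B * t + lam0)) + 4 * \<gamma> * B * t\<^sup>2 + 32 * B * t\<^sup>2 + t)"
      by (simp add: algebra_simps)
    then show ?case
      using w unfolding w_def[symmetric] l0 by (simp add: pos_divide_le_eq mult.commute)
  qed
qed

theorem theorem2p7:
  fixes \<beta> :: real and f g :: "real \<Rightarrow> real"
  assumes "\<beta> > 0"
    and "H1_with_deriv f g"
  shows "(\<lambda>n. m_min n \<beta> f / (omega n)^2) \<longlonglongrightarrow>
           \<beta> powr (1/3) * integral {0..1} (\<lambda>x. \<bar>g x\<bar> powr (2/3))"
proof -
  define B I where "B = \<beta> powr (1/3)" and "I = integral {0..1} (\<lambda>x. \<bar>g x\<bar> powr (2/3))"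
  have t01: "\<forall>\<^sub>F t::real in at_right 0. 0 < t \<and> t < 1"
    using eventually_at_right_real[of 0 "1::real"] by (simp add: eventually_mono)
  \<comment> \<open>For a given threshold \<open>a\<close> the parameter \<open>t\<close> is fixed
    first, small enough for the bound depending on \<open>t\<close> to lie on the correct side of
    \<open>a\<close>; only then does \<open>n\<close> tend to infinity.\<close>
  have "(\<lambda>n. m_min n \<beta> f / (omega n)^2) \<longlonglongrightarrow> B * I"
  proof (rule order_tendstoI)
    fix a assume a: "a < B * I"
    have "((\<lambda>t. (1 - t)\<^sup>2 * (B * I) - (10 * \<beta> + 5 * B + 5) * t) \<longlongrightarrow> (1 - 0)\<^sup>2 * (B * I) - (10 * \<beta> + 5 * B + 5) * 0)
      (at_right 0)"
      by (intro tendsto_intros)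
    then have "\<forall>\<^sub>F t in at_right 0. a < (1 - t)\<^sup>2 * (B * I) - (10 * \<beta> + 5 * B + 5) * t"
      by (rule order_tendstoD) (use a in simp)
    from eventually_happens[OF eventually_conj[OF this t01]]
    obtain t where t: "a < (1 - t)\<^sup>2 * (B * I) - (10 * \<beta> + 5 * B + 5) * t" "0 < t" "t < 1"
      by auto
    show "\<forall>\<^sub>F n in sequentially. a < m_min n \<beta> f / (omega n)^2"
      using m_min_lower[OF assms(2,1) t(2,3)] unfolding B_def[symmetric] I_def[symmetric]
      by eventually_elim (use t(1) in linarith)
  next
    fix a assume a: "B * I < a"
    let ?h = "\<lambda>t. (1 + t) / (1 - t) * (B * I + (B * t + B * t powr (1/3)))
      + 4 * ((1 + t) / (1 - t)) * B * t\<^sup>2 + 32 * B * t\<^sup>2 + t"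
    have "((\<lambda>t::real. t powr (1/3)) \<longlongrightarrow> 0) (at_right 0)" by real_asymp
    then have "(?h \<longlongrightarrow> (1 + 0) / (1 - 0) * (B * I + (B * 0 + B * 0))
      + 4 * ((1 + 0) / (1 - 0)) * B * 0\<^sup>2 + 32 * B * 0\<^sup>2 + 0) (at_right 0)"
      by (intro tendsto_intros) auto
    then have "\<forall>\<^sub>F t in at_right 0. ?h t < a"
      by (rule order_tendstoD) (use a in simp)
    from eventually_happens[OF eventually_conj[OF this t01]]
    obtain t where t: "?h t < a" "0 < t" "t < 1" by auto
    show "\<forall>\<^sub>F n in sequentially. m_min n \<beta> f / (omega n)^2 < a"
      using m_min_upper[OF assms(2,1) t(2,3)] unfolding B_def[symmetric] I_def[symmetric]
      by eventually_elim (use t(1) in linarith)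
  qed
  then show ?thesis by (simp only: B_def I_def)
qed

end
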